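(* Let $B$ be a compact $3$-dimensional special integral affine manifold with local affine coordinates $\{x^1,x^2,x^3\}$, let $\hat X=T^*B/\hat\Lambda$ be the associated $T^3$-fibration over $B$ with its canonical symplectic form $\omega=\sum_{j=1}^3 dx^j\wedge dy_j$, and let $g=g(t)$ be a smooth one-parameter family of Hessian metrics on $B$ with local potentials $\phi=\phi(t)$, solving the flow (the semi-flat reduction of the Type IIB flow) $$\partial_t g_{jk}=\frac14\frac{\partial^2}{\partial x^j\partial x^k}\det g .$$ Let $\varphi=\varphi(t)$ and $\hat\varphi=\hat\varphi(t)$ be the associated $3$-forms on $\hat X$, i.e. the real and imaginary parts of $\Omega=dz_1\wedge dz_2\wedge dz_3$, where $z_j=x_j+iy_j$ and $x_j=\partial\phi/\partial x^j$. Then $\varphi$ satisfies the Type IIA flow $$\partial_t\varphi=\frac1{16}\,d\Lambda_\omega d\big(|\varphi|^2\hat\varphi\big).$$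
   Context: A special integral affine manifold $B$ of dimension $3$ is a manifold covered by local coordinate charts $\{x^1,x^2,x^3\}$ whose transition functions lie in $\mathrm{SL}(3,\mathbb Z)\ltimes\mathbb R^3$. A Hessian metric on $B$ is a Riemannian metric $g$ for which there is locally a convex function $\phi$ (the local potential) with $g_{jk}=\partial^2\phi/\partial x^j\partial x^k$; $\det g$ denotes $\det(g_{jk})$ in these affine coordinates, which is globally well defined. The affine structure $\{x^j\}$ on $B$ is fixed, while $g$ (equivalently $\phi$) varies with $t$. Let $\{y_1,y_2,y_3\}$ be the cotangent fibre coordinates on $T^*B$ associated to $\{x^1,x^2,x^3\}$ (the covector $\sum_j y_j\,dx^j$ has coordinates $y_j$), and let $\hat\Lambda=\mathbb Z\,dx^1+\mathbb Z\,dx^2+\mathbb Z\,dx^3$, a well-defined fibrewise lattice. Set $\hat X=T^*B/\hat\Lambda$; the form $\omega=\sum_j dx^j\wedge dy_j$ descends to $\hat X$ and is independent of $t$. The dual affine coordinates are $x_j=\partial\phi/\partial x^j$ (depending on $t$), so $dx_j=\sum_k g_{jk}\,dx^k$. With $z_j=x_j+iy_j$, put $\Omega=\varphi+i\hat\varphi=dz_1\wedge dz_2\wedge dz_3$, that is $$\varphi=dx_1\wedge dx_2\wedge dx_3-dx_1\wedge dy_2\wedge dy_3-dy_1\wedge dx_2\wedge dy_3-dy_1\wedge dy_2\wedge dx_3,$$ $$\hat\varphi=dx_1\wedge dx_2\wedge dy_3+dx_1\wedge dy_2\wedge dx_3+dy_1\wedge dx_2\wedge dx_3-dy_1\wedge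 dy_2\wedge dy_3.$$ These are well-defined forms on $\hat X$. The function $|\varphi|^2$ is defined by $\varphi\wedge\hat\varphi=|\varphi|^2\,\omega^3/3!$. $\Lambda_\omega$ is the contraction operator on forms associated with $\omega$, normalized by $\Lambda_\omega\omega=3$; explicitly $\Lambda_\omega=\sum_j\iota_{\partial/\partial y_j}\iota_{\partial/\partial x^j}$, where the vector fields are taken in the coordinates $(x^1,x^2,x^3,y_1,y_2,y_3)$. The time derivative $\partial_t\varphi$ is taken on the fixed manifold $\hat X$, with the coordinates $(x^j,y_j)$ fixed. *)

theory Defs
  imports "HOL-Analysis.Analysis"
begin

section \<open>Smooth functions\<close>

text \<open>
  The derivative is taken within \<open>S\<close>, so that the notion also applies to sets such as
  \<open>[0,T) \<times> U\<close> with \<open>U\<close> open. It is only used for open sets and for products of a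
  nondegenerate interval with an open set, where the derivative is unique.
\<close>

primrec Ck_on :: "nat \<Rightarrow> ('a::real_normed_vector \<Rightarrow> 'b::real_normed_vector) \<Rightarrow> 'a set \<Rightarrow> bool" where
  "Ck_on 0 f S \<longleftrightarrow> continuous_on S f"
| "Ck_on (Suc k) f S \<longleftrightarrow>
     (\<exists>f'. (\<forall>x\<in>S. (f has_derivative f' x) (at x within S)) \<and> (\<forall>v. Ck_on k (\<lambda>x. f' x v) S))"

definition smooth_on :: "'a::real_normed_vector set \<Rightarrow> ('a \<Rightarrow> 'b::real_normed_vector) \<Rightarrow> bool" where
  "smooth_on S f \<longleftrightarrow> (\<forall>k. Ck_on k f S)"

definition partial :: "3 \<Rightarrow> (real^3 \<Rightarrow> real) \<Rightarrow> real^3 \<Rightarrow> real" where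
  "partial j f x = frechet_derivative f (at x) (axis j 1)"


section \<open>Special integral affine manifolds\<close>

text \<open>A chart is a pair of its domain and its coordinate map \<open>(x\<^sup>1, x\<^sup>2, x\<^sup>3)\<close>.\<close>

type_synonym 'b chart = "'b set \<times> ('b \<Rightarrow> real^3)"

definition chart_image :: "'b chart \<Rightarrow> (real^3) set" where
  "chart_image c = snd c ` fst c"

definition is_chart :: "'b topology \<Rightarrow> 'b chart \<Rightarrow> bool" where
  "is_chart B c \<longleftrightarrow> openin B (fst c) \<and> open (chart_image c) \<and>
     homeomorphic_map (subtopology B (fst c)) (top_of_set (chart_image c)) (snd c)"

definition SL3Z :: "(real^3^3) set" where
  "SL3Z = {M. (\<forall>i j. M $ i $ j \<in> \<int>) \<and> det M = 1}"

text \<open>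
  Near \<open>p\<close> the transition function from \<open>c\<close> to \<open>c'\<close> is \<open>x \<mapsto> M x + b\<close>. The matrix may vary with
  the connected component of the overlap, and it is determined by \<open>p\<close>.
\<close>

definition transition ::
    "'b topology \<Rightarrow> 'b chart \<Rightarrow> 'b chart \<Rightarrow> 'b \<Rightarrow> real^3^3 \<Rightarrow> real^3 \<Rightarrow> bool" where
  "transition B c c' p M b \<longleftrightarrow>
     (\<exists>W. openin B W \<and> p \<in> W \<and> W \<subseteq> fst c \<inter> fst c' \<and> (\<forall>q\<in>W. snd c' q = M *v snd c q + b))"

definition special_integral_affine_manifold :: "'b topology \<Rightarrow> 'b chart set \<Rightarrow> bool" where
  "special_integral_affine_manifold B A \<longleftrightarrow>
     Hausdorff_space B \<and> second_countable B \<and>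
     (\<forall>c\<in>A. is_chart B c) \<and> (\<Union>c\<in>A. fst c) = topspace B \<and>
     (\<forall>c\<in>A. \<forall>c'\<in>A. \<forall>p \<in> fst c \<inter> fst c'. \<exists>M\<in>SL3Z. \<exists>b. transition B c c' p M b)"


section \<open>Hessian metrics\<close>

text \<open>
  A metric is given by its coefficient matrices: \<open>g c x $ j $ k\<close> is \<open>g\<^sub>j\<^sub>k\<close> in the chart \<open>c\<close>, at
  the point with coordinates \<open>x\<close>.
\<close>

type_synonym 'b metric = "'b chart \<Rightarrow> real^3 \<Rightarrow> real^3^3"

definition riemannian_metric :: "'b topology \<Rightarrow> 'b chart set \<Rightarrow> 'b metric \<Rightarrow> bool" where
  "riemannian_metric B A g \<longleftrightarrow>
     (\<forall>c\<in>A. smooth_on (chart_image c) (g c) \<and>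
        (\<forall>x\<in>chart_image c. transpose (g c x) = g c x \<and> (\<forall>v. v \<noteq> 0 \<longrightarrow> v \<bullet> (g c x *v v) > 0))) \<and>
     (\<forall>c\<in>A. \<forall>c'\<in>A. \<forall>p M b. transition B c c' p M b \<longrightarrow>
        g c (snd c p) = transpose M ** g c' (snd c' p) ** M)"

definition local_potential :: "'b metric \<Rightarrow> 'b chart \<Rightarrow> real^3 \<Rightarrow> (real^3 \<Rightarrow> real) \<Rightarrow> bool" where
  "local_potential g c x \<phi> \<longleftrightarrow>
     (\<exists>W. open W \<and> x \<in> W \<and> W \<subseteq> chart_image c \<and> smooth_on W \<phi> \<and> convex_on W \<phi> \<and>
        (\<forall>u\<in>W. \<forall>j k. g c u $ j $ k = partial j (partial k \<phi>) u))"

definition hessian_metric :: "'b topology \<Rightarrow> 'b chart set \<Rightarrow> 'b metric \<Rightarrow> bool" where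
  "hessian_metric B A g \<longleftrightarrow> riemannian_metric B A g \<and>
     (\<forall>c\<in>A. \<forall>x\<in>chart_image c. \<exists>\<phi>. local_potential g c x \<phi>)"

definition smooth_family :: "'b chart set \<Rightarrow> real set \<Rightarrow> (real \<Rightarrow> 'b metric) \<Rightarrow> bool" where
  "smooth_family A I g \<longleftrightarrow> (\<forall>c\<in>A. smooth_on (I \<times> chart_image c) (\<lambda>(t, x). g t c x))"

definition semiflat_type_IIB_flow :: "'b chart set \<Rightarrow> real set \<Rightarrow> (real \<Rightarrow> 'b metric) \<Rightarrow> bool" where
  "semiflat_type_IIB_flow A I g \<longleftrightarrow>
     (\<forall>t\<in>I. \<forall>c\<in>A. \<forall>x\<in>chart_image c. \<forall>j k.
        ((\<lambda>s. g s c x $ j $ k) has_real_derivative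
           1/4 * partial j (partial k (\<lambda>u. det (g t c u))) x) (at t within I))"


section \<open>The torus fibration \<open>T\<^sup>*B/\<Lambda>\<close>\<close>

text \<open>
  A covector at \<open>p\<close> is the family of its component vectors \<open>(y\<^sub>1, y\<^sub>2, y\<^sub>3)\<close> in all charts around
  \<open>p\<close>. If \<open>x' = M x + b\<close>, then \<open>\<Sum>\<^sub>k y'\<^sub>k dx'\<^sup>k = \<Sum>\<^sub>j y\<^sub>j dx\<^sup>j\<close> amounts to \<open>y = M\<^sup>T y'\<close>. The value 0
  in the other charts only serves to make the representation unique.
\<close>

definition cotangent_space ::
    "'b topology \<Rightarrow> 'b chart set \<Rightarrow> 'b \<Rightarrow> ('b chart \<Rightarrow> real^3) set" where
  "cotangent_space B A p =
     {\<xi>. (\<forall>c. c \<notin> A \<or> p \<notin> fst c \<longrightarrow> \<xi> c = 0) \<and>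
         (\<forall>c\<in>A. \<forall>c'\<in>A. \<forall>M b. transition B c c' p M b \<longrightarrow> \<xi> c = transpose M *v \<xi> c')}"

definition cotangent_bundle ::
    "'b topology \<Rightarrow> 'b chart set \<Rightarrow> ('b \<times> ('b chart \<Rightarrow> real^3)) set" where
  "cotangent_bundle B A = Sigma (topspace B) (cotangent_space B A)"

definition dual_lattice ::
    "'b topology \<Rightarrow> 'b chart set \<Rightarrow> 'b \<Rightarrow> ('b chart \<Rightarrow> real^3) set" where
  "dual_lattice B A p = {\<xi> \<in> cotangent_space B A p. \<forall>c\<in>A. p \<in> fst c \<longrightarrow> (\<forall>j. \<xi> c $ j \<in> \<int>)}"

definition X_hat ::
    "'b topology \<Rightarrow> 'b chart set \<Rightarrow> ('b \<times> ('b chart \<Rightarrow> real^3)) set set" where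
  "X_hat B A = cotangent_bundle B A //
     {((p, \<xi>), (p', \<xi>')). (p, \<xi>) \<in> cotangent_bundle B A \<and> (p', \<xi>') \<in> cotangent_bundle B A \<and>
        p = p' \<and> (\<lambda>c. \<xi> c - \<xi>' c) \<in> dual_lattice B A p}"


section \<open>Differential forms in coordinates\<close>

text \<open>
  The value of a \<open>k\<close>-form at a point is a function of a list of \<open>k\<close> tangent vectors. The wedge
  product is the sum over \<open>(p,q)\<close>-shuffles, the set \<open>S\<close> being the set of positions of the
  arguments of the first factor; hence \<open>(dx \<and> dy)(u, v) = dx(u) dy(v) - dx(v) dy(u)\<close>.
\<close>

type_synonym ('a, 'v) dform = "'a \<Rightarrow> 'a list \<Rightarrow> 'v"

definition fun_form :: "('a \<Rightarrow> 'v) \<Rightarrow> ('a, 'v) dform" where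
  "fun_form f = (\<lambda>z vs. f z)"

definition wedge ::
    "nat \<Rightarrow> nat \<Rightarrow> ('a, 'v::real_normed_field) dform \<Rightarrow> ('a, 'v) dform \<Rightarrow> ('a, 'v) dform" where
  "wedge p q \<alpha> \<beta> = (\<lambda>z vs.
     \<Sum>S | S \<subseteq> {..<p + q} \<and> card S = p.
       (-1) ^ card {(i, j). i \<in> S \<and> j \<in> {..<p + q} - S \<and> j < i} *
       (\<alpha> z (nths vs S) * \<beta> z (nths vs (- S))))"

definition ext_d ::
    "('a::real_normed_vector, 'v::real_normed_vector) dform \<Rightarrow> ('a, 'v) dform" where
  "ext_d \<alpha> = (\<lambda>z vs. \<Sum>i<length vs. (-1) ^ i *\<^sub>R
     frechet_derivative (\<lambda>w. \<alpha> w (take i vs @ drop (Suc i) vs)) (at z) (vs ! i))"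

definition contract :: "'a \<Rightarrow> ('a, 'v) dform \<Rightarrow> ('a, 'v) dform" where
  "contract u \<alpha> = (\<lambda>z vs. \<alpha> z (u # vs))"

definition alternating_multilinear ::
    "nat \<Rightarrow> ('a::real_vector list \<Rightarrow> 'v::real_vector) \<Rightarrow> bool" where
  "alternating_multilinear k f \<longleftrightarrow>
     (\<forall>vs. length vs = k \<longrightarrow> (\<forall>i<k. linear (\<lambda>v. f (vs[i := v])))) \<and>
     (\<forall>vs. length vs = k \<longrightarrow> (\<forall>i<k. \<forall>j<k. i \<noteq> j \<and> vs ! i = vs ! j \<longrightarrow> f vs = 0))"


section \<open>Differential forms on the torus fibration\<close>

text \<open>
  Coordinates \<open>(x\<^sup>1, x\<^sup>2, x\<^sup>3, y\<^sub>1, y\<^sub>2, y\<^sub>3)\<close>. A chart \<open>c\<close> of the base gives the local parametrization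
  \<open>coord_domain c \<rightarrow> X_hat\<close> sending \<open>(x, y)\<close> to the class of the covector \<open>\<Sum>\<^sub>j y\<^sub>j dx\<^sup>j\<close>, which is a
  local diffeomorphism. The \<open>y\<^sub>j\<close> of a point of \<open>X_hat\<close> are determined up to integers.
\<close>

type_synonym coord = "(real^3) \<times> (real^3)"

definition coord_domain :: "'b chart \<Rightarrow> coord set" where
  "coord_domain c = chart_image c \<times> UNIV"

text \<open>
  A form on \<open>X_hat\<close> is given by its expressions \<open>\<alpha> c\<close> in these parametrizations. They have to
  agree at any two coordinate vectors of the same point \<open>e\<close> of \<open>X_hat\<close>, where tangent vectors
  transform by \<open>(u, w) \<mapsto> (M u, M\<^sup>-\<^sup>T w)\<close>. The case \<open>c = c'\<close>, \<open>M = 1\<close> is the invariance under the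
  lattice.
\<close>

definition differential_form ::
    "'b topology \<Rightarrow> 'b chart set \<Rightarrow> nat \<Rightarrow> ('b chart \<Rightarrow> (coord, 'v::real_normed_vector) dform) \<Rightarrow> bool" where
  "differential_form B A k \<alpha> \<longleftrightarrow>
     (\<forall>c\<in>A. \<forall>z\<in>coord_domain c. alternating_multilinear k (\<alpha> c z)) \<and>
     (\<forall>c\<in>A. \<forall>vs. length vs = k \<longrightarrow> smooth_on (coord_domain c) (\<lambda>z. \<alpha> c z vs)) \<and>
     (\<forall>e\<in>X_hat B A. \<forall>p \<xi> \<xi>'. (p, \<xi>) \<in> e \<and> (p, \<xi>') \<in> e \<longrightarrow>
        (\<forall>c\<in>A. \<forall>c'\<in>A. \<forall>M b. transition B c c' p M b \<longrightarrow>
           (\<forall>vs. length vs = k \<longrightarrow>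
              \<alpha> c (snd c p, \<xi> c) vs =
              \<alpha> c' (snd c' p, \<xi>' c') (map (\<lambda>(u, w). (M *v u, matrix_inv (transpose M) *v w)) vs))))"

definition omega :: "(coord, real) dform" where
  "omega = (\<lambda>z vs. \<Sum>j\<in>UNIV.
     wedge 1 1 (ext_d (fun_form (\<lambda>(x, y). x $ j))) (ext_d (fun_form (\<lambda>(x, y). y $ j))) z vs)"

definition Lambda_omega :: "(coord, real) dform \<Rightarrow> (coord, real) dform" where
  "Lambda_omega \<alpha> = (\<lambda>z vs. \<Sum>j\<in>UNIV. contract (0, axis j 1) (contract (axis j 1, 0) \<alpha>) z vs)"

definition z_coord :: "(real^3 \<Rightarrow> real) \<Rightarrow> 3 \<Rightarrow> coord \<Rightarrow> complex" where
  "z_coord \<phi> j = (\<lambda>(x, y). Complex (partial j \<phi> x) (y $ j))"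

text \<open>
  The potential near a point is arbitrary: two potentials of the same metric differ by an affine
  function of \<open>x\<close>, which does not change \<open>dz\<^sub>j\<close>.
\<close>

definition Omega :: "'b metric \<Rightarrow> 'b chart \<Rightarrow> (coord, complex) dform" where
  "Omega g c = (\<lambda>z vs.
     let \<phi> = (SOME \<phi>. local_potential g c (fst z) \<phi>);
         dz = (\<lambda>j. ext_d (fun_form (z_coord \<phi> j)))
     in wedge 2 1 (wedge 1 1 (dz 1) (dz 2)) (dz 3) z vs)"

definition varphi :: "'b metric \<Rightarrow> 'b chart \<Rightarrow> (coord, real) dform" where
  "varphi g c = (\<lambda>z vs. Re (Omega g c z vs))"

definition varphi_hat :: "'b metric \<Rightarrow> 'b chart \<Rightarrow> (coord, real) dform" where
  "varphi_hat g c = (\<lambda>z vs. Im (Omega g c z vs))"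

text \<open>
  \<open>norm_sq \<alpha> \<beta>\<close> is the function \<open>f\<close> with \<open>\<alpha> \<and> \<beta> = f \<omega>\<^sup>3/3!\<close>; for \<open>\<alpha> = varphi\<close> and
  \<open>\<beta> = varphi_hat\<close> it is \<open>|varphi|\<^sup>2\<close>.
\<close>

definition norm_sq :: "(coord, real) dform \<Rightarrow> (coord, real) dform \<Rightarrow> coord \<Rightarrow> real" where
  "norm_sq \<alpha> \<beta> z = (THE r. \<forall>vs. length vs = 6 \<longrightarrow>
     wedge 3 3 \<alpha> \<beta> z vs = r * (wedge 4 2 (wedge 2 2 omega omega) omega z vs / fact 3))"

end

theory Submission
  imports Defs
begin

text \<open>
  Everything happens in one chart of the base, where the metric is a symmetric matrix \<open>G(x)\<close> and
  a tangent vector \<open>v = (u, w)\<close> has \<open>dz\<^sub>j(v) = \<Sum>\<^sub>k G\<^sub>k\<^sub>j u\<^sub>k + i w\<^sub>j\<close>. Thus \<open>\<Omega>\<close> of three vectors is the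
  \<open>3 \<times> 3\<close> determinant \<open>vol\<close> of their vectors \<open>dz\<close> (\<open>Omega_eq_vol\<close>), and only \<open>G\<close> enters, not
  the choice of the potential.

  The coefficient of the flow comes from \<open>|Re \<Omega>|\<^sup>2 = 4 det G\<close> (\<open>norm_sq_eq\<close>). To compare the two
  6-forms in its definition it is enough to evaluate them on one basis (\<open>top_form_eq_0\<close>), and the
  shuffle sums are computed by the rule
  \<open>\<iota>\<^sub>v(\<alpha> \<and> \<beta>) = \<iota>\<^sub>v\<alpha> \<and> \<beta> + (-1)\<^sup>p \<alpha> \<and> \<iota>\<^sub>v\<beta>\<close> (\<open>wedge_Cons\<close>).

  The metric is Hessian, so \<open>\<partial>\<^sub>l G\<^sub>k\<^sub>j\<close> is a third derivative of the potential and hence symmetric in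
  \<open>l, k\<close>. This makes the \<open>dz\<^sub>j\<close> closed, and with them \<open>\<Omega>\<close> and its contractions with constant
  vectors \<open>\<partial>/\<partial>y\<^sub>j\<close> (\<open>Omega_form_closed\<close>, \<open>Omega_slice_closed\<close>). With \<open>D = det G\<close> and
  \<open>\<psi> = Im \<Omega>\<close> this gives \<open>d(D \<psi>) = dD \<and> \<psi>\<close>. Because \<open>G\<close> is symmetric, \<open>\<Lambda>\<psi> = 0\<close>; because \<open>D\<close>
  does not depend on \<open>y\<close>, the contraction is
  \<open>\<Lambda>(dD \<and> \<psi>) = \<Sum>\<^sub>j \<partial>\<^sub>jD \<iota>(\<partial>/\<partial>y\<^sub>j) \<psi>\<close> (\<open>Lambda_d_weighted_Omega\<close>).
  A second \<open>d\<close> replaces \<open>\<partial>\<^sub>jD\<close> by \<open>d(\<partial>\<^sub>jD)\<close>. Since \<open>\<iota>(\<partial>/\<partial>y\<^sub>j) \<Omega>\<close> is \<open>i\<close> times the \<open>j\<close>-th minor of the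
  remaining \<open>dz\<close>, its imaginary part is the real part of that minor. So the result is the real
  part of \<open>\<Omega>\<close> with each \<open>dz\<^sub>j\<close> in turn replaced by \<open>d(\<partial>\<^sub>jD)\<close> (\<open>d_Lambda_d_weighted_Omega\<close>), and the
  factor is \<open>4/16 = 1/4\<close>. That is the derivative of \<open>Re \<Omega>\<close> in time, because the flow of the
  metric says \<open>\<partial>\<^sub>t dz\<^sub>j = 1/4 d(\<partial>\<^sub>jD)\<close> (\<open>varphi_has_real_derivative\<close>).

  That the local expressions define forms on the torus fibration rests on \<open>det M = 1\<close> for the
  linear part \<open>M\<close> of a change of charts (\<open>differential_form_of_Omega\<close>).
\<close>

section \<open>Smooth functions and symmetry of the second derivative\<close>

lemma has_derivative_eq_on:
  assumes "(f has_derivative f') (at x within S)" "x \<in> S" "\<And>y. y \<in> S \<Longrightarrow> f y = g y"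
  shows "(g has_derivative f') (at x within S)"
  by (rule has_derivative_transform[OF assms(2) _ assms(1)]) (simp add: assms(3))

lemma Ck_on_cong:
  assumes "Ck_on k f S" "\<And>x. x \<in> S \<Longrightarrow> f x = g x"
  shows "Ck_on k g S"
proof (cases k)
  case 0
  then show ?thesis using assms by (simp cong: continuous_on_cong)
next
  case (Suc m)
  then show ?thesis using assms has_derivative_eq_on[of f _ _ S g]
    by (fastforce)
qed

text \<open>
  The definition of \<open>Ck_on (Suc k)\<close> speaks only of the derivatives. That the function itself is
  \<open>Ck_on k\<close> is what the product rule needs in \<open>Ck_on_mult\<close>.
\<close>

lemma Ck_on_SucD: "Ck_on (Suc k) f S \<Longrightarrow> Ck_on k f S"
proof (induction k arbitrary: f)
  case 0
  then show ?case
    by (metis Ck_on.simps has_derivative_continuous_on)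
next
  case (Suc k)
  then show ?case by (metis Ck_on.simps(2))
qed

lemma Ck_on_const: "Ck_on k (\<lambda>x. c) S"
proof (induction k arbitrary: c)
  case (Suc k)
  then show ?case
    by (auto intro!: exI[of _ "\<lambda>_ _. 0"])
qed simp

lemma Ck_on_add:
  "Ck_on k f S \<Longrightarrow> Ck_on k g S \<Longrightarrow> Ck_on k (\<lambda>x. f x + g x) S"
proof (induction k arbitrary: f g)
  case 0
  then show ?case by (auto intro: continuous_on_add)
next
  case (Suc k)
  from Suc.prems obtain f' g' where
    "\<forall>x\<in>S. (f has_derivative f' x) (at x within S)" "\<forall>v. Ck_on k (\<lambda>x. f' x v) S"
    "\<forall>x\<in>S. (g has_derivative g' x) (at x within S)" "\<forall>v. Ck_on k (\<lambda>x. g' x v) S"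
    by auto
  then show ?case
    by (auto intro!: exI[of _ "\<lambda>x v. f' x v + g' x v"] has_derivative_add Suc.IH)
qed

lemma Ck_on_mult:
  fixes f g :: "'a::real_normed_vector \<Rightarrow> 'b::real_normed_algebra"
  shows "Ck_on k f S \<Longrightarrow> Ck_on k g S \<Longrightarrow> Ck_on k (\<lambda>x. f x * g x) S"
proof (induction k arbitrary: f g)
  case 0
  then show ?case by (auto intro: continuous_on_mult)
next
  case (Suc k)
  from Suc.prems obtain f' g' where d:
    "\<forall>x\<in>S. (f has_derivative f' x) (at x within S)" "\<forall>v. Ck_on k (\<lambda>x. f' x v) S"
    "\<forall>x\<in>S. (g has_derivative g' x) (at x within S)" "\<forall>v. Ck_on k (\<lambda>x. g' x v) S"
    by auto
  have "Ck_on k f S" "Ck_on k g S"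
    using Suc.prems Ck_on_SucD by blast+
  with d show ?case
    by (auto intro!: exI[of _ "\<lambda>x v. f x * g' x v + f' x v * g x"] has_derivative_mult
        Ck_on_add Suc.IH)
qed

lemma Ck_on_bounded_linear:
  assumes "bounded_linear L"
  shows "Ck_on k f S \<Longrightarrow> Ck_on k (\<lambda>x. L (f x)) S"
proof (induction k arbitrary: f)
  case 0
  then show ?case using assms bounded_linear.continuous_on by auto
next
  case (Suc k)
  from Suc.prems obtain f' where
    "\<forall>x\<in>S. (f has_derivative f' x) (at x within S)" "\<forall>v. Ck_on k (\<lambda>x. f' x v) S"
    by auto
  then show ?case
    by (auto intro!: exI[of _ "\<lambda>x v. L (f' x v)"] Suc.IH bounded_linear.has_derivative[OF assms])
qed

lemma Ck_on_fst: "Ck_on k f S \<Longrightarrow> Ck_on k (\<lambda>z. f (fst z)) (S \<times> T)"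
proof (induction k arbitrary: f)
  case 0
  then show ?case
    by (auto intro!: continuous_on_compose2[of S f] continuous_intros)
next
  case (Suc k)
  from Suc.prems obtain f' where d:
    "\<forall>x\<in>S. (f has_derivative f' x) (at x within S)" "\<forall>v. Ck_on k (\<lambda>x. f' x v) S"
    by auto
  have "((\<lambda>z. f (fst z)) has_derivative (\<lambda>v. f' (fst z) (fst v))) (at z within S \<times> T)"
    if "z \<in> S \<times> T" for z
  proof -
    have "(f has_derivative f' (fst z)) (at (fst z) within fst ` (S \<times> T))"
      by (rule has_derivative_subset[of _ _ _ S]) (use d that in auto)
    then show ?thesis
      by (rule has_derivative_in_compose[OF has_derivative_fst[OF has_derivative_ident]])
  qed
  then show ?case using d
    by (auto intro!: exI[of _ "\<lambda>z v. f' (fst z) (fst v)"] Suc.IH simp del: split_paired_All)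
qed

lemma Ck_on_partial:
  assumes "open S" "Ck_on (Suc k) f S"
  shows "Ck_on k (partial j f) S"
proof -
  from assms obtain f' where d:
    "\<forall>x\<in>S. (f has_derivative f' x) (at x within S)" "\<forall>v. Ck_on k (\<lambda>x. f' x v) S"
    by auto
  have "f' x (axis j 1) = partial j f x" if "x \<in> S" for x
    using d that assms(1) by (metis at_within_open frechet_derivative_at partial_def)
  then show ?thesis using d(2) Ck_on_cong by blast
qed

lemma Ck_on_differentiable:
  assumes "open S" "Ck_on (Suc k) f S" "x \<in> S"
  shows "(f has_derivative frechet_derivative f (at x)) (at x)"
  using assms by (metis Ck_on.simps(2) at_within_open frechet_derivative_at)

lemma frechet_derivative_partial:
  assumes "(f has_derivative f') (at x)"
  shows "f' v = (\<Sum>j\<in>UNIV. v $ j * partial j f x)"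
proof -
  have f': "partial j f x = f' (axis j 1)" for j
    using frechet_derivative_at[OF assms] by (simp add: partial_def)
  have lin: "linear f'"
    using assms has_derivative_linear by blast
  have "v = (\<Sum>j\<in>UNIV. v $ j *\<^sub>R axis j 1)"
    by (simp add: vec_eq_iff axis_def if_distrib cong: if_cong)
  then have "f' v = f' (\<Sum>j\<in>UNIV. v $ j *\<^sub>R axis j 1)" by simp
  also have "\<dots> = (\<Sum>j\<in>UNIV. v $ j * f' (axis j 1))"
    by (simp add: linear_sum[OF lin] linear_cmul[OF lin])
  finally show ?thesis by (simp add: f')
qed

text \<open>
  The mean value theorem twice: first in direction \<open>u\<close> for \<open>f(y + s v) - f(y)\<close>, then in
  direction \<open>v\<close> for \<open>f' u\<close>.
\<close>

lemma second_difference_mean_value: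
  fixes f :: "'a::real_normed_vector \<Rightarrow> real"
  assumes s: "s > 0" and ball: "\<And>a b. a \<in> {0..s} \<Longrightarrow> b \<in> {0..s} \<Longrightarrow> x + a *\<^sub>R u + b *\<^sub>R v \<in> S"
    and f': "\<And>y. y \<in> S \<Longrightarrow> (f has_derivative f' y) (at y)"
    and f'': "\<And>y. y \<in> S \<Longrightarrow> ((\<lambda>y. f' y u) has_derivative f'' y) (at y)"
  shows "\<exists>a\<in>{0..s}. \<exists>b\<in>{0..s}.
    f (x + s *\<^sub>R u + s *\<^sub>R v) - f (x + s *\<^sub>R u) - f (x + s *\<^sub>R v) + f x
      = s * (s * f'' (x + a *\<^sub>R u + b *\<^sub>R v) v)"
proof -
  let ?p = "\<lambda>a b. x + a *\<^sub>R u + b *\<^sub>R v"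
  have line1: "((\<lambda>r. f (?p r b)) has_derivative (\<lambda>h. f' (?p a b) (h *\<^sub>R u))) (at a within {0..s})"
    if "a \<in> {0..s}" "b \<in> {0..s}" for a b
    by (rule has_derivative_compose[where f = "\<lambda>r. ?p r b" and g = f, OF _ f'[OF ball[OF that]]])
       (auto intro!: derivative_eq_intros)
  have line2: "((\<lambda>r. f' (?p a r) u) has_derivative (\<lambda>h. f'' (?p a b) (h *\<^sub>R v))) (at b within {0..s})"
    if "a \<in> {0..s}" "b \<in> {0..s}" for a b
    by (rule has_derivative_compose[where f = "?p a" and g = "\<lambda>y. f' y u", OF _ f''[OF ball[OF that]]])
       (auto intro!: derivative_eq_intros)
  have lin: "linear (f' y)" if "y \<in> S" for y
    using f'[OF that] has_derivative_linear by blast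
  have lin': "linear (f'' y)" if "y \<in> S" for y
    using f''[OF that] has_derivative_linear by blast
  have "\<exists>a\<in>{0<..<s}. (f (?p s s) - f (?p s 0)) - (f (?p 0 s) - f (?p 0 0))
      = (\<lambda>h. f' (?p a s) (h *\<^sub>R u) - f' (?p a 0) (h *\<^sub>R u)) (s - 0)"
    by (rule mvt_simple[OF s], rule has_derivative_diff; rule line1) (use s in auto)
  then obtain a where a: "a \<in> {0<..<s}"
    and eq: "f (?p s s) - f (?p s 0) - (f (?p 0 s) - f (?p 0 0))
       = f' (?p a s) (s *\<^sub>R u) - f' (?p a 0) (s *\<^sub>R u)" by auto
  have "\<exists>b\<in>{0<..<s}. f' (?p a s) u - f' (?p a 0) u = (\<lambda>h. f'' (?p a b) (h *\<^sub>R v)) (s - 0)"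
    by (rule mvt_simple[OF s], rule line2) (use a in auto)
  then obtain b where b: "b \<in> {0<..<s}" and eq2: "f' (?p a s) u - f' (?p a 0) u = f'' (?p a b) (s *\<^sub>R v)"
    by auto
  have "f' (?p a s) (s *\<^sub>R u) = s * f' (?p a s) u" "f' (?p a 0) (s *\<^sub>R u) = s * f' (?p a 0) u"
    "f'' (?p a b) (s *\<^sub>R v) = s * f'' (?p a b) v"
    using linear_cmul[OF lin[OF ball[of a s]]] linear_cmul[OF lin[OF ball[of a 0]]]
      linear_cmul[OF lin'[OF ball[of a b]]] a b s by auto
  with eq eq2 have "f (?p s s) - f (?p s 0) - f (?p 0 s) + f (?p 0 0) = s * (s * f'' (?p a b) v)"
    by (simp add: algebra_simps flip: eq2)
  then show ?thesis using a b
    by (intro bexI[of _ a] bexI[of _ b]) auto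
qed

text \<open>
  The second difference is symmetric in \<open>u\<close> and \<open>v\<close>. By \<open>second_difference_mean_value\<close> it equals
  \<open>s\<^sup>2\<close> times either mixed derivative at points which tend to \<open>x\<close> with \<open>s\<close>, so continuity of the
  mixed derivatives gives equality at \<open>x\<close>.
\<close>

lemma second_derivative_symmetric:
  fixes f :: "'a::real_normed_vector \<Rightarrow> real"
  assumes S: "open S" "x \<in> S" and f: "Ck_on 2 f S"
    and f': "\<And>y. y \<in> S \<Longrightarrow> (f has_derivative f' y) (at y)"
    and u: "((\<lambda>y. f' y u) has_derivative f'u) (at x)"
    and v: "((\<lambda>y. f' y v) has_derivative f'v) (at x)"
  shows "f'u v = f'v u"
proof -
  from f obtain F where F: "\<forall>x\<in>S. (f has_derivative F x) (at x within S)"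
      "\<forall>v. Ck_on 1 (\<lambda>x. F x v) S"
    by (auto simp: numeral_2_eq_2)
  have Ff': "F y = f' y" if "y \<in> S" for y
    using F(1) f' S(1) that by (metis at_within_open has_derivative_unique)
  have "\<exists>H. (\<forall>y\<in>S. ((\<lambda>y. f' y w) has_derivative H y) (at y)) \<and> (\<forall>v. continuous_on S (\<lambda>y. H y v))"
    for w
  proof -
    have "Ck_on (Suc 0) (\<lambda>y. f' y w) S"
      using F(2) Ff' Ck_on_cong[of 1 "\<lambda>y. F y w" S "\<lambda>y. f' y w"] by simp
    then obtain H where "\<forall>y\<in>S. ((\<lambda>y. f' y w) has_derivative H y) (at y within S)"
      "\<forall>v. continuous_on S (\<lambda>y. H y v)" by auto
    then show ?thesis using S(1) by (metis at_within_open)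
  qed
  then obtain H where H: "\<And>w y. y \<in> S \<Longrightarrow> ((\<lambda>y. f' y w) has_derivative H w y) (at y)"
    and cH: "\<And>w v. continuous_on S (\<lambda>y. H w y v)" by metis
  have eq: "f'u = H u x" "f'v = H v x"
    using u v H[OF S(2)] has_derivative_unique by blast+
  have "H u x v = H v x u"
  proof (rule ccontr)
    assume ne: "H u x v \<noteq> H v x u"
    define e where "e = \<bar>H u x v - H v x u\<bar> / 2"
    have e: "e > 0" using ne by (simp add: e_def)
    have "isCont (\<lambda>y. H u y v) x" "isCont (\<lambda>y. H v y u) x"
      using cH S continuous_on_eq_continuous_at by blast+
    then obtain d1 d2 where d12: "d1 > 0" "d2 > 0"
        "\<And>y. dist y x < d1 \<Longrightarrow> dist (H u y v) (H u x v) < e"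
        "\<And>y. dist y x < d2 \<Longrightarrow> dist (H v y u) (H v x u) < e"
      using e unfolding continuous_at_eps_delta by metis
    obtain d3 where d3: "d3 > 0" "ball x d3 \<subseteq> S"
      using S open_contains_ball by blast
    \<comment> \<open>the factor 2 makes the displaced points lie strictly inside the three balls\<close>
    define s where "s = min d1 (min d2 d3) / (2 * (norm u + norm v + 1))"
    have s: "s > 0" using d12 d3 by (simp add: s_def add_nonneg_pos)
    have near: "dist (x + a *\<^sub>R u + b *\<^sub>R v) x < min d1 (min d2 d3)"
      if "a \<in> {0..s}" "b \<in> {0..s}" for a b
    proof -
      have "dist (x + a *\<^sub>R u + b *\<^sub>R v) x \<le> norm (a *\<^sub>R u) + norm (b *\<^sub>R v)"
        by (simp add: dist_norm add.assoc norm_triangle_ineq del: norm_scaleR)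
      also have "\<dots> \<le> s * norm u + s * norm v"
        using that by (auto intro!: add_mono mult_right_mono)
      also have "\<dots> < s * (2 * (norm u + norm v + 1))"
        using s mult_nonneg_nonneg[of s "norm u"] mult_nonneg_nonneg[of s "norm v"]
        by (simp add: algebra_simps add_nonneg_pos)
      also have "\<dots> = min d1 (min d2 d3)"
        using add_nonneg_pos[of "norm u + norm v" 1] by (simp add: s_def)
      finally show ?thesis .
    qed
    have inS: "x + a *\<^sub>R u + b *\<^sub>R v \<in> S" if "a \<in> {0..s}" "b \<in> {0..s}" for a b
      using near[OF that] d3(2) by (auto simp: mem_ball dist_commute subset_eq)
    have inS': "x + a *\<^sub>R v + b *\<^sub>R u \<in> S" if "a \<in> {0..s}" "b \<in> {0..s}" for a b
      using inS[OF that(2,1)] by (simp add: algebra_simps)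
    obtain a b where ab: "a \<in> {0..s}" "b \<in> {0..s}"
      "f (x + s *\<^sub>R u + s *\<^sub>R v) - f (x + s *\<^sub>R u) - f (x + s *\<^sub>R v) + f x
         = s * (s * H u (x + a *\<^sub>R u + b *\<^sub>R v) v)"
      using second_difference_mean_value[of s x u v S f f' "H u", OF s inS f' H] by blast
    obtain b' a' where ab': "b' \<in> {0..s}" "a' \<in> {0..s}"
      "f (x + s *\<^sub>R v + s *\<^sub>R u) - f (x + s *\<^sub>R v) - f (x + s *\<^sub>R u) + f x
         = s * (s * H v (x + b' *\<^sub>R v + a' *\<^sub>R u) u)"
      using second_difference_mean_value[of s x v u S f f' "H v", OF s inS' f' H] by blast
    have "s * (s * H u (x + a *\<^sub>R u + b *\<^sub>R v) v) = s * (s * H v (x + b' *\<^sub>R v + a' *\<^sub>R u) u)"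
      using ab(3) ab'(3) by (simp add: algebra_simps)
    then have "H u (x + a *\<^sub>R u + b *\<^sub>R v) v = H v (x + a' *\<^sub>R u + b' *\<^sub>R v) u"
      using s by (simp add: algebra_simps)
    moreover have "dist (H u (x + a *\<^sub>R u + b *\<^sub>R v) v) (H u x v) < e"
      "dist (H v (x + a' *\<^sub>R u + b' *\<^sub>R v) u) (H v x u) < e"
      using near[OF ab(1,2)] near[OF ab'(2,1)] d12 by auto
    ultimately show False
      by (simp add: e_def dist_real_def abs_if split: if_splits)
  qed
  then show ?thesis by (simp add: eq)
qed

section \<open>Wedge products and alternating forms\<close>

definition shuffles_upto :: "nat \<Rightarrow> nat \<Rightarrow> nat set set" where
  "shuffles_upto n p = {S. S \<subseteq> {..<n} \<and> card S = p}"

definition inversions :: "nat \<Rightarrow> nat set \<Rightarrow> nat" where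
  "inversions n S = card {(i, j). i \<in> S \<and> j \<in> {..<n} - S \<and> j < i}"

text \<open>
  A shuffle is classified by whether the first argument goes to the first factor.
\<close>

lemma shuffles_upto_Suc:
  "shuffles_upto (Suc n) (Suc p) =
     (\<lambda>S. insert 0 (Suc ` S)) ` shuffles_upto n p \<union> image Suc ` shuffles_upto n (Suc p)"
proof (intro equalityI subsetI)
  fix S assume S: "S \<in> shuffles_upto (Suc n) (Suc p)"
  then have fin: "finite S" by (auto simp: shuffles_upto_def intro: finite_subset)
  define T where "T = {i. Suc i \<in> S}"
  have im: "Suc ` T = S - {0}"
    by (auto simp: T_def image_iff) (metis not0_implies_Suc)
  have sub: "T \<subseteq> {..<n}" using S by (auto simp: T_def shuffles_upto_def)
  have cT: "card T = card (S - {0})"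
    using card_image[of Suc T] im by simp
  show "S \<in> (\<lambda>S. insert 0 (Suc ` S)) ` shuffles_upto n p \<union> image Suc ` shuffles_upto n (Suc p)"
  proof (cases "0 \<in> S")
    case True
    then have "S = insert 0 (Suc ` T)" "card T = p"
      using im cT S fin by (auto simp: shuffles_upto_def)
    then show ?thesis using sub by (auto simp: shuffles_upto_def)
  next
    case False
    then have "S = Suc ` T" "card T = Suc p"
      using im cT S by (auto simp: shuffles_upto_def)
    then show ?thesis using sub by (auto simp: shuffles_upto_def)
  qed
next
  fix S assume "S \<in> (\<lambda>S. insert 0 (Suc ` S)) ` shuffles_upto n p \<union> image Suc ` shuffles_upto n (Suc p)"
  then show "S \<in> shuffles_upto (Suc n) (Suc p)"
    by (auto simp: shuffles_upto_def card_image intro: finite_subset)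
      (subst card_insert_disjoint; auto simp: card_image intro: finite_subset)
qed

lemma inversions_insert_0:
  "inversions (Suc n) (insert 0 (Suc ` S)) = inversions n S"
proof -
  have "{(i, j). i \<in> insert 0 (Suc ` S) \<and> j \<in> {..<Suc n} - insert 0 (Suc ` S) \<and> j < i} =
    map_prod Suc Suc ` {(i, j). i \<in> S \<and> j \<in> {..<n} - S \<and> j < i}" (is "?L = ?R")
  proof (intro equalityI subsetI)
    fix x assume x: "x \<in> ?L"
    obtain i j where ij: "x = (i, j)" by force
    with x obtain i' j' where "i = Suc i'" "j = Suc j'"
      by (cases i; cases j) auto
    with x ij show "x \<in> ?R" by auto
  qed auto
  moreover have "inj_on (map_prod Suc Suc) X" for X by (auto simp: inj_on_def)
  ultimately show ?thesis by (simp add: inversions_def card_image)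
qed

text \<open>
  If the first argument goes to the second factor, it is an inversion with each of the \<open>p\<close>
  positions of the first factor.
\<close>

lemma inversions_Suc_image:
  assumes "S \<in> shuffles_upto n p"
  shows "inversions (Suc n) (Suc ` S) = p + inversions n S"
proof -
  let ?I = "{(i, j). i \<in> S \<and> j \<in> {..<n} - S \<and> j < i}"
  have fin: "finite S" using assms by (auto simp: shuffles_upto_def intro: finite_subset)
  have finI: "finite ?I"
    by (rule finite_subset[of _ "S \<times> {..<n}"]) (use fin in auto)
  have "{(i, j). i \<in> Suc ` S \<and> j \<in> {..<Suc n} - Suc ` S \<and> j < i} =
    (\<lambda>i. (Suc i, 0)) ` S \<union> map_prod Suc Suc ` ?I" (is "?L = ?R")
  proof (intro equalityI subsetI)
    fix x assume x: "x \<in> ?L"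
    obtain i j where ij: "x = (i, j)" by force
    with x obtain i' where i': "i = Suc i'" "i' \<in> S" by auto
    show "x \<in> ?R"
      using x ij i' by (cases j) auto
  qed auto
  moreover have "inj_on (map_prod Suc Suc) X" for X by (auto simp: inj_on_def)
  moreover have "card ((\<lambda>i. (Suc i, 0::nat)) ` S) = p"
    using assms by (subst card_image) (auto simp: inj_on_def shuffles_upto_def)
  ultimately show ?thesis
    by (simp add: inversions_def, subst card_Un_disjoint)
      (use fin finI in \<open>auto simp: card_image\<close>)
qed

lemma finite_shuffles_upto: "finite (shuffles_upto n p)"
  by (rule finite_subset[of _ "Pow {..<n}"]) (auto simp: shuffles_upto_def)

lemma wedge_shuffles:
  "wedge p q \<alpha> \<beta> z vs = (\<Sum>S\<in>shuffles_upto (p + q) p.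
     (-1) ^ inversions (p + q) S * (\<alpha> z (nths vs S) * \<beta> z (nths vs (- S))))"
  by (simp add: wedge_def shuffles_upto_def inversions_def)

lemma sum_shuffles_upto_Suc:
  "(\<Sum>S\<in>shuffles_upto (Suc n) (Suc p). h S) =
    (\<Sum>S\<in>shuffles_upto n p. h (insert 0 (Suc ` S))) + (\<Sum>S\<in>shuffles_upto n (Suc p). h (Suc ` S))"
proof -
  have inj: "inj_on (\<lambda>S. insert 0 (Suc ` S)) X" "inj_on (image Suc) X" for X
    by (auto simp: inj_on_def)
  show ?thesis
    unfolding shuffles_upto_Suc
    by (subst sum.union_disjoint)
      (auto simp: finite_shuffles_upto sum.reindex[OF inj(1)] sum.reindex[OF inj(2)])
qed

text \<open>
  The contraction rule for a wedge product. It turns the sum over shuffles into a recursion on the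
  list of arguments, by which wedge products are evaluated and shown to be alternating.
\<close>

lemma wedge_Cons:
  "wedge (Suc p) (Suc q) \<alpha> \<beta> z (v # vs) =
     wedge p (Suc q) (contract v \<alpha>) \<beta> z vs + (-1) ^ Suc p * wedge (Suc p) q \<alpha> (contract v \<beta>) z vs"
proof -
  have n1: "nths (v # vs) (insert 0 (Suc ` S)) = v # nths vs S"
    "nths (v # vs) (- insert 0 (Suc ` S)) = nths vs (- S)"
    "nths (v # vs) (Suc ` S) = nths vs S"
    "nths (v # vs) (- Suc ` S) = v # nths vs (- S)" for S
    by (auto simp: nths_Cons image_iff intro!: arg_cong[where f = "nths vs"])
  show ?thesis
    unfolding wedge_shuffles[of "Suc p" "Suc q"] add_Suc sum_shuffles_upto_Suc n1 inversions_insert_0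
    by (simp add: wedge_shuffles contract_def inversions_Suc_image power_add sum_distrib_left
        mult.assoc cong: sum.cong)
qed

lemma wedge_0_left: "length vs = q \<Longrightarrow> wedge 0 q \<alpha> \<beta> z vs = \<alpha> z [] * \<beta> z vs"
proof -
  assume l: "length vs = q"
  have "shuffles_upto q 0 = {{}}"
    by (auto simp: shuffles_upto_def) (metis card_0_eq empty_iff finite_lessThan finite_subset)
  then show ?thesis using l by (simp add: wedge_shuffles inversions_def nths_all)
qed

lemma wedge_0_right: "length vs = p \<Longrightarrow> wedge p 0 \<alpha> \<beta> z vs = \<alpha> z vs * \<beta> z []"
proof -
  assume l: "length vs = p"
  have "shuffles_upto p p = {{..<p}}"
    by (auto simp: shuffles_upto_def)
      (metis card_lessThan card_subset_eq finite_lessThan lessThan_iff subset_eq)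
  moreover have "nths vs (- {..<p}) = []"
    using l length_nths[of vs "- {..<p}"] by (simp add: conj_commute not_le[symmetric] cong: conj_cong)
  moreover have "inversions p {..<p} = 0"
    by (auto simp: inversions_def)
  ultimately show ?thesis using l by (simp add: wedge_shuffles)
qed

text \<open>
  Alternating multilinear functions of \<open>k\<close> arguments, in a form adapted to recursion on the list:
  linear in the first argument, zero if the first two agree, and the same again after the first
  argument is fixed. Adjacent arguments suffice, since they generate all transpositions.
\<close>

primrec alternating_form :: "nat \<Rightarrow> ('a::real_vector list \<Rightarrow> 'v::real_vector) \<Rightarrow> bool" where
  "alternating_form 0 f \<longleftrightarrow> True"
| "alternating_form (Suc k) f \<longleftrightarrow>
     (\<forall>vs. length vs = k \<longrightarrow> linear (\<lambda>v. f (v # vs))) \<and>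
     (\<forall>v vs. Suc (length vs) = k \<longrightarrow> f (v # v # vs) = 0) \<and>
     (\<forall>v. alternating_form k (\<lambda>vs. f (v # vs)))"

lemma alternating_form_add:
  "alternating_form k f \<Longrightarrow> alternating_form k g \<Longrightarrow> alternating_form k (\<lambda>vs. f vs + g vs)"
  by (induction k arbitrary: f g) (auto intro: linear_compose_add)

lemma linear_mult_const:
  fixes f :: "'a::real_vector \<Rightarrow> 'v::real_normed_algebra"
  assumes "linear f"
  shows "linear (\<lambda>v. c * f v)" "linear (\<lambda>v. f v * c)"
  by (rule linearI; simp add: linear_add[OF assms] linear_cmul[OF assms] algebra_simps)+

lemma alternating_form_mult:
  fixes f :: "'a::real_vector list \<Rightarrow> 'v::real_normed_algebra"
  shows "alternating_form k f \<Longrightarrow> alternating_form k (\<lambda>vs. c * f vs)"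
  by (induction k arbitrary: f)
    (auto intro!: linear_mult_const)

lemma alternating_form_cong:
  assumes "\<And>vs. length vs = k \<Longrightarrow> f vs = g vs"
  shows "alternating_form k f \<longleftrightarrow> alternating_form k g"
  using assms
proof (induction k arbitrary: f g)
  case (Suc k)
  have "alternating_form k (\<lambda>vs. f (v # vs)) = alternating_form k (\<lambda>vs. g (v # vs))" for v
    by (rule Suc.IH) (simp add: Suc.prems)
  moreover have "linear (\<lambda>v. f (v # vs)) = linear (\<lambda>v. g (v # vs))" if "length vs = k" for vs
    using that Suc.prems by simp
  moreover have "f (v # v # vs) = g (v # v # vs)" if "Suc (length vs) = k" for v vs
    using that Suc.prems by simp
  ultimately show ?case by (simp del: split_paired_All)
qed simp

lemma length_nths_shuffle:
  assumes "S \<in> shuffles_upto (p + q) p" "length vs = p + q"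
  shows "length (nths vs S) = p" "length (nths vs (- S)) = q"
proof -
  have S: "S \<subseteq> {..<p + q}" "card S = p" using assms by (auto simp: shuffles_upto_def)
  have "{i. i < p + q \<and> i \<in> S} = S" "{i. i < p + q \<and> i \<in> - S} = {..<p + q} - S"
    using S by auto
  then show "length (nths vs S) = p" "length (nths vs (- S)) = q"
    using S assms(2) by (simp_all add: length_nths card_Diff_subset finite_subset)
qed

lemma wedge_cong:
  assumes "\<And>us. length us = p \<Longrightarrow> \<alpha> z us = \<alpha>' z us" "\<And>us. length us = q \<Longrightarrow> \<beta> z us = \<beta>' z us"
    and "length vs = p + q"
  shows "wedge p q \<alpha> \<beta> z vs = wedge p q \<alpha>' \<beta>' z vs"
  unfolding wedge_shuffles
  by (intro sum.cong refl) (simp add: assms length_nths_shuffle)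

lemma wedge_linear_left:
  fixes A :: "'a::real_vector \<Rightarrow> ('b, 'v::real_normed_field) dform"
  assumes "\<And>us. length us = p \<Longrightarrow> linear (\<lambda>v. A v z us)" "length vs = p + q"
  shows "linear (\<lambda>v. wedge p q (A v) \<beta> z vs)"
  unfolding wedge_shuffles
  by (intro linear_compose_sum ballI linear_mult_const)
    (simp add: assms length_nths_shuffle)

lemma wedge_linear_right:
  fixes A :: "'a::real_vector \<Rightarrow> ('b, 'v::real_normed_field) dform"
  assumes "\<And>us. length us = q \<Longrightarrow> linear (\<lambda>v. A v z us)" "length vs = p + q"
  shows "linear (\<lambda>v. wedge p q \<alpha> (A v) z vs)"
  unfolding wedge_shuffles
  by (intro linear_compose_sum ballI linear_mult_const)
    (simp add: assms length_nths_shuffle)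

text \<open>
  With \<open>wedge_contract_right\<close>, this shows that the two terms of \<open>\<iota>\<^sub>v\<iota>\<^sub>v(\<alpha> \<and> \<beta>)\<close> which are left when
  \<open>\<iota>\<^sub>v\<iota>\<^sub>v\<alpha> = 0\<close> and \<open>\<iota>\<^sub>v\<iota>\<^sub>v\<beta> = 0\<close> are multiples of \<open>\<iota>\<^sub>v\<alpha> \<and> \<iota>\<^sub>v\<beta>\<close> with opposite signs.
\<close>

lemma wedge_contract_left:
  assumes "\<And>us. Suc (length us) = p \<Longrightarrow> \<alpha> z (v # v # us) = 0" "length vs = p + q"
  shows "wedge p (Suc q) (contract v \<alpha>) \<beta> z (v # vs)
    = (-1) ^ p * wedge p q (contract v \<alpha>) (contract v \<beta>) z vs"
proof (cases p)
  case 0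
  then show ?thesis using assms by (simp add: wedge_0_left contract_def)
next
  case (Suc p')
  have "wedge p' (Suc q) (contract v (contract v \<alpha>)) \<beta> z vs
      = wedge p' (Suc q) (\<lambda>_ _. 0) \<beta> z vs"
    by (rule wedge_cong) (use assms Suc in \<open>auto simp: contract_def\<close>)
  also have "\<dots> = 0" by (simp add: wedge_def)
  finally show ?thesis using Suc by (simp add: wedge_Cons)
qed

lemma wedge_contract_right:
  assumes "\<And>us. Suc (length us) = q \<Longrightarrow> \<beta> z (v # v # us) = 0" "length vs = p + q"
  shows "wedge (Suc p) q \<alpha> (contract v \<beta>) z (v # vs)
    = wedge p q (contract v \<alpha>) (contract v \<beta>) z vs"
proof (cases q)
  case 0
  then show ?thesis using assms by (simp add: wedge_0_right contract_def)
next
  case (Suc q')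
  have "wedge (Suc p) q' \<alpha> (contract v (contract v \<beta>)) z vs
      = wedge (Suc p) q' \<alpha> (\<lambda>_ _. 0) z vs"
    by (rule wedge_cong) (use assms Suc in \<open>auto simp: contract_def\<close>)
  also have "\<dots> = 0" by (simp add: wedge_def)
  finally show ?thesis using Suc by (simp add: wedge_Cons)
qed

lemma alternating_form_wedge:
  fixes \<alpha> \<beta> :: "('a::real_vector, 'v::real_normed_field) dform"
  assumes "alternating_form p (\<alpha> z)" "alternating_form q (\<beta> z)"
  shows "alternating_form (p + q) (wedge p q \<alpha> \<beta> z)"
  using assms
proof (induction "p + q" arbitrary: p q \<alpha> \<beta>)
  case 0
  then show ?case by simp
next
  case (Suc n)
  consider "p = 0" | "q = 0" | p' q' where "p = Suc p'" "q = Suc q'"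
    by (cases p; cases q) auto
  then show ?case
  proof cases
    case 1
    then show ?thesis
      using alternating_form_mult[OF Suc.prems(2)] alternating_form_cong[OF wedge_0_left]
      by fastforce
  next
    case 2
    have "alternating_form p (\<lambda>vs. \<alpha> z vs * \<beta> z [])"
      using alternating_form_mult[OF Suc.prems(1), of "\<beta> z []"] by (simp add: mult.commute)
    with 2 show ?thesis
      using alternating_form_cong[OF wedge_0_right] by fastforce
  next
    case 3
    note alt = Suc.prems[unfolded 3 alternating_form.simps]
    have a: "alternating_form p' (contract v \<alpha> z)" "alternating_form q' (contract v \<beta> z)" for v
      using alt by (simp_all add: contract_def)
    have n: "n = p' + Suc q'" using 3 Suc.hyps by auto
    have "linear (\<lambda>v. wedge p q \<alpha> \<beta> z (v # vs))" if "length vs = n" for vs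
      unfolding 3 wedge_Cons
      by (intro linear_compose_add linear_mult_const wedge_linear_left wedge_linear_right)
        (use alt that n in \<open>auto simp: contract_def\<close>)
    moreover have "wedge p q \<alpha> \<beta> z (v # v # vs) = 0" if "Suc (length vs) = n" for v vs
    proof -
      have "wedge p' (Suc q') (contract v \<alpha>) \<beta> z (v # vs)
          = (-1) ^ p' * wedge p' q' (contract v \<alpha>) (contract v \<beta>) z vs"
        by (rule wedge_contract_left) (use alt that n in auto)
      moreover have "wedge (Suc p') q' \<alpha> (contract v \<beta>) z (v # vs)
          = wedge p' q' (contract v \<alpha>) (contract v \<beta>) z vs"
        by (rule wedge_contract_right) (use alt that n in auto)
      ultimately show ?thesis unfolding 3 wedge_Cons by simp
    qed
    moreover have "alternating_form n (\<lambda>vs. wedge p q \<alpha> \<beta> z (v # vs))" for v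
    proof -
      have "alternating_form n (wedge p' (Suc q') (contract v \<alpha>) \<beta> z)"
        unfolding n by (rule Suc.hyps(1)) (use n a Suc.prems 3 in auto)
      moreover have "alternating_form (Suc p' + q') (wedge (Suc p') q' \<alpha> (contract v \<beta>) z)"
        by (rule Suc.hyps(1)) (use n a Suc.prems 3 in auto)
      then have "alternating_form n (wedge (Suc p') q' \<alpha> (contract v \<beta>) z)" by (simp add: n)
      ultimately show ?thesis
        unfolding 3 wedge_Cons by (intro alternating_form_add alternating_form_mult)
    qed
    ultimately show ?thesis
      unfolding Suc.hyps(2)[symmetric] alternating_form.simps(2) by blast
  qed
qed

lemma alternating_form_linear_slot:
  "alternating_form (Suc (length xs + length ys)) f \<Longrightarrow> linear (\<lambda>v. f (xs @ v # ys))"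
proof (induction xs arbitrary: f)
  case (Cons x xs)
  then show ?case using Cons.IH[of "\<lambda>vs. f (x # vs)"] by simp
qed simp

lemma alternating_form_adjacent:
  "alternating_form (Suc (Suc (length xs + length ys))) f \<Longrightarrow> f (xs @ v # v # ys) = 0"
proof (induction xs arbitrary: f)
  case (Cons x xs)
  then show ?case using Cons.IH[of "\<lambda>vs. f (x # vs)"] by simp
qed simp

lemma alternating_form_swap:
  assumes "alternating_form (Suc (Suc (length xs + length ys))) f"
  shows "f (xs @ v # w # ys) = - f (xs @ w # v # ys)"
proof -
  have l1: "linear (\<lambda>x. f (xs @ x # y # ys))" for y
    using alternating_form_linear_slot[of xs "y # ys" f] assms by simp
  have l2: "linear (\<lambda>x. f (xs @ y # x # ys))" for y
    using alternating_form_linear_slot[of "xs @ [y]" ys f] assms by simp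
  have "0 = f (xs @ (v + w) # (v + w) # ys)"
    using alternating_form_adjacent[OF assms] by simp
  also have "\<dots> = f (xs @ v # (v + w) # ys) + f (xs @ w # (v + w) # ys)"
    by (rule linear_add[OF l1])
  also have "\<dots> = f (xs @ v # w # ys) + f (xs @ w # v # ys)"
    using alternating_form_adjacent[OF assms] linear_add[OF l2, of v v w] linear_add[OF l2, of w v w]
    by simp
  finally show ?thesis by (simp add: eq_neg_iff_add_eq_0)
qed

text \<open>
  Only the vanishing of \<open>f\<close> matters for \<open>top_form_eq_0\<close>, so the sign of the permutation need not
  be tracked.
\<close>

lemma alternating_form_move:
  assumes "alternating_form (Suc (length xs + length ys + length zs)) f"
  shows "f (xs @ ys @ v # zs) = 0 \<longleftrightarrow> f (xs @ v # ys @ zs) = 0"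
  using assms
proof (induction ys arbitrary: xs)
  case (Cons y ys)
  have "f (xs @ (y # ys) @ v # zs) = 0 \<longleftrightarrow> f ((xs @ [y]) @ v # ys @ zs) = 0"
    using Cons.IH[of "xs @ [y]"] Cons.prems by simp
  also have "\<dots> \<longleftrightarrow> f (xs @ v # (y # ys) @ zs) = 0"
    using alternating_form_swap[of xs "ys @ zs" f y v] Cons.prems by (simp add: add.assoc)
  finally show ?case .
qed simp

lemma alternating_form_permute:
  assumes "mset ys = mset zs" "alternating_form (length xs + length ys) f"
  shows "f (xs @ ys) = 0 \<longleftrightarrow> f (xs @ zs) = 0"
  using assms
proof (induction ys arbitrary: xs zs)
  case (Cons y ys)
  then have "y \<in> set zs" by (metis list.set_intros(1) set_mset_mset)
  then obtain us ws where zs: "zs = us @ y # ws" by (meson split_list)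
  have m: "mset ys = mset (us @ ws)" using Cons.prems(1) zs by simp
  then have len: "length ys = length us + length ws" by (metis length_append size_mset)
  have "f (xs @ y # ys) = 0 \<longleftrightarrow> f ((xs @ [y]) @ us @ ws) = 0"
    using Cons.IH[OF m, of "xs @ [y]"] Cons.prems by simp
  also have "\<dots> \<longleftrightarrow> f (xs @ zs) = 0"
    using alternating_form_move[of xs us ws f y] Cons.prems len zs by (simp add: add.assoc)
  finally show ?case .
qed simp

text \<open>
  A list of basis vectors either repeats one of them or is a permutation of the whole basis. The
  arguments are then freed one at a time by linearity, from the left.
\<close>

lemma top_form_eq_0:
  assumes alt: "alternating_form (length bs) f" and bs: "distinct bs" "span (set bs) = UNIV" "f bs = 0"
    and len: "length vs = length bs"
  shows "f vs = 0"
proof -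
  have basis: "f vs = 0" if vs: "length vs = length bs" "set vs \<subseteq> set bs" for vs
  proof (cases "distinct vs")
    case True
    then have "set vs = set bs"
      using vs bs(1) by (metis card_subset_eq distinct_card finite_set)
    then have "mset vs = mset bs" using True bs(1) set_eq_iff_mset_eq_distinct by blast
    then show ?thesis using alternating_form_permute[of vs bs "[]" f] vs alt bs(3) by simp
  next
    case False
    then obtain us v ws xs where d: "vs = us @ [v] @ ws @ [v] @ xs"
      using not_distinct_decomp by blast
    then have "f vs = 0 \<longleftrightarrow> f ((us @ [v]) @ v # ws @ xs) = 0"
      using alternating_form_move[of "us @ [v]" ws xs f v] alt vs
      by (simp add: add.assoc del: alternating_form.simps)
    then show ?thesis
      using alternating_form_adjacent[of us "ws @ xs" f v] alt vs d
      by (simp add: add.assoc del: alternating_form.simps)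
  qed
  have "f (xs @ ys) = 0" if "length (xs @ ys) = length bs" "set ys \<subseteq> set bs" for xs ys
    using that
  proof (induction xs arbitrary: ys rule: rev_induct)
    case Nil
    then show ?case using basis by simp
  next
    case (snoc x xs)
    have lin: "linear (\<lambda>v. f (xs @ v # ys))"
      by (rule alternating_form_linear_slot) (use alt snoc.prems in simp)
    have "x \<in> span (set bs)" using bs(2) by simp
    then have "f (xs @ x # ys) = 0"
    proof (induction rule: span_induct)
      case base
      then show ?case
        using linear_0[OF lin] linear_add[OF lin] linear_cmul[OF lin] by (auto simp: subspace_def)
    next
      case (step v)
      then show ?case using snoc.IH[of "v # ys"] snoc.prems by simp
    qed
    then show ?case by simp
  qed
  from this[of vs "[]"] len show ?thesis by simp
qed

section \<open>The holomorphic volume form as a determinant\<close>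

text \<open>
  The values \<open>dz\<^sub>1, dz\<^sub>2, dz\<^sub>3\<close> on a tangent vector. The real part is the transpose of \<open>G\<close> applied to
  the base component, which is how \<open>\<partial>\<^sub>k\<partial>\<^sub>j\<phi> = G\<^sub>k\<^sub>j\<close> arises as the derivative of \<open>\<partial>\<^sub>j\<phi>\<close>.
\<close>

definition dz_vec :: "real^3^3 \<Rightarrow> coord \<Rightarrow> 3 \<Rightarrow> complex" where
  "dz_vec G v j = Complex (\<Sum>k\<in>UNIV. G $ k $ j * fst v $ k) (snd v $ j)"

text \<open>
  The determinant with rows \<open>a\<close>, \<open>b\<close>, \<open>c\<close>.
\<close>

definition vol :: "(3 \<Rightarrow> complex) \<Rightarrow> (3 \<Rightarrow> complex) \<Rightarrow> (3 \<Rightarrow> complex) \<Rightarrow> complex" where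
  "vol a b c = a 1 * (b 2 * c 3 - b 3 * c 2) - a 2 * (b 1 * c 3 - b 3 * c 1)
     + a 3 * (b 1 * c 2 - b 2 * c 1)"

lemma ext_d_fun_form: "ext_d (fun_form f) z [v] = frechet_derivative f (at z) v"
  by (simp add: ext_d_def fun_form_def)

lemma wedge_1_1:
  "wedge 1 1 \<alpha> \<beta> z [a, b] = \<alpha> z [a] * \<beta> z [b] - \<alpha> z [b] * \<beta> z [a]"
  by (simp add: wedge_Cons wedge_0_left wedge_0_right contract_def)

lemma wedge_1_1_1:
  "wedge 2 1 (wedge 1 1 \<alpha> \<beta>) \<gamma> z [a, b, c] =
     (\<alpha> z [a] * \<beta> z [b] - \<alpha> z [b] * \<beta> z [a]) * \<gamma> z [c]
   - (\<alpha> z [a] * \<beta> z [c] - \<alpha> z [c] * \<beta> z [a]) * \<gamma> z [b]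
   + (\<alpha> z [b] * \<beta> z [c] - \<alpha> z [c] * \<beta> z [b]) * \<gamma> z [a]"
  using wedge_1_1[of \<alpha> \<beta> z]
  by (simp add: numeral_2_eq_2 wedge_Cons[of 1 0, simplified] wedge_Cons[of 0 0, simplified]
      wedge_0_left wedge_0_right contract_def)

lemma frechet_derivative_z_coord:
  assumes "local_potential g c x \<phi>"
  shows "frechet_derivative (z_coord \<phi> j) (at (x, y)) v = dz_vec (g c x) v j"
proof -
  from assms obtain W where W: "open W" "x \<in> W" "smooth_on W \<phi>"
    "\<forall>u\<in>W. \<forall>j k. g c u $ j $ k = partial j (partial k \<phi>) u"
    unfolding local_potential_def by blast
  let ?f' = "frechet_derivative (partial j \<phi>) (at x)"
  have "Ck_on (Suc 0) (partial j \<phi>) W"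
    using W(1,3) Ck_on_partial smooth_on_def by blast
  then have d: "(partial j \<phi> has_derivative ?f') (at x)"
    using W(1,2) Ck_on_differentiable by blast
  have comp: "((\<lambda>z. partial j \<phi> (fst z)) has_derivative (\<lambda>v. ?f' (fst v))) (at (x, y))"
    by (rule has_derivative_compose[where g = "partial j \<phi>" and f = fst, OF has_derivative_fst[OF has_derivative_ident]])
      (simp add: d)
  have "((\<lambda>z. of_real (partial j \<phi> (fst z)) + \<i> * of_real (snd z $ j)) has_derivative
      (\<lambda>v. of_real (?f' (fst v)) + \<i> * of_real (snd v $ j))) (at (x, y))"
    by (intro derivative_intros comp bounded_linear.has_derivative[OF bounded_linear_vec_nth])
  then have "(z_coord \<phi> j has_derivative (\<lambda>v. Complex (?f' (fst v)) (snd v $ j))) (at (x, y))"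
    by (simp add: z_coord_def complex_eq_iff case_prod_unfold Complex_eq)
  then have "frechet_derivative (z_coord \<phi> j) (at (x, y)) v = Complex (?f' (fst v)) (snd v $ j)"
    by (simp flip: frechet_derivative_at)
  also have "?f' (fst v) = (\<Sum>k\<in>UNIV. g c x $ k $ j * fst v $ k)"
    using frechet_derivative_partial[OF d] W by (simp add: mult.commute)
  finally show ?thesis by (simp add: dz_vec_def)
qed

lemma Omega_eq_vol:
  assumes "\<exists>\<phi>. local_potential g c x \<phi>"
  shows "Omega g c (x, y) [u, v, w] = vol (dz_vec (g c x) u) (dz_vec (g c x) v) (dz_vec (g c x) w)"
proof -
  \<comment> \<open>the potential chosen in the definition of \<open>\<Omega>\<close>; the result depends only on its Hessian\<close>
  define \<phi> where "\<phi> = (SOME \<phi>. local_potential g c x \<phi>)"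
  have "local_potential g c x \<phi>" unfolding \<phi>_def using assms by (rule someI_ex)
  note d = frechet_derivative_z_coord[OF this]
  show ?thesis
    unfolding Omega_def Let_def fst_conv \<phi>_def[symmetric] wedge_1_1_1 ext_d_fun_form d
    by (simp add: vol_def algebra_simps)
qed

lemma omega_eq:
  "omega z [u, v] = (\<Sum>j\<in>UNIV. fst u $ j * snd v $ j - fst v $ j * snd u $ j)"
proof -
  have d: "((\<lambda>(x, y). x $ j) has_derivative (\<lambda>(x, y). x $ j)) (at z)"
    "((\<lambda>(x, y). y $ j) has_derivative (\<lambda>(x, y). y $ j)) (at z)" for j and z :: coord
    unfolding case_prod_unfold
    by (intro bounded_linear.has_derivative[OF bounded_linear_vec_nth] derivative_intros)+
  show ?thesis
    unfolding omega_def wedge_1_1 ext_d_fun_form frechet_derivative_at[OF d(1), symmetric]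
      frechet_derivative_at[OF d(2), symmetric]
    by (simp add: case_prod_unfold)
qed

lemma dz_vec_linear:
  "dz_vec G (u + v) j = dz_vec G u j + dz_vec G v j"
  "dz_vec G (r *\<^sub>R u) j = of_real r * dz_vec G u j"
  by (simp_all add: dz_vec_def complex_eq_iff algebra_simps sum.distrib sum_distrib_left)

lemma vol_linear:
  "vol (\<lambda>j. a j + a' j) b c = vol a b c + vol a' b c"
  "vol a (\<lambda>j. b j + b' j) c = vol a b c + vol a b' c"
  "vol a b (\<lambda>j. c j + c' j) = vol a b c + vol a b c'"
  "vol (\<lambda>j. r * a j) b c = r * vol a b c"
  "vol a (\<lambda>j. r * b j) c = r * vol a b c"
  "vol a b (\<lambda>j. r * c j) = r * vol a b c"
  by (simp_all add: vol_def algebra_simps)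

lemma vol_alternating: "vol a a b = 0" "vol a b b = 0" "vol a b a = 0"
  by (simp_all add: vol_def algebra_simps)

lemma vol_linear_compose:
  "linear (\<lambda>u. vol (dz_vec G u) b c)" "linear (\<lambda>u. vol a (dz_vec G u) c)"
  "linear (\<lambda>u. vol a b (dz_vec G u))"
  by (rule linearI; simp add: dz_vec_linear[abs_def] vol_linear scaleR_conv_of_real)+

lemma alternating_form_compose_linear:
  assumes "linear L"
  shows "alternating_form k f \<Longrightarrow> alternating_form k (\<lambda>vs. L (f vs))"
proof (induction k arbitrary: f)
  case (Suc k)
  have "linear (\<lambda>v. L (f (v # vs)))" if "length vs = k" for vs
    using linear_compose[OF _ assms, of "\<lambda>v. f (v # vs)"] Suc.prems that by (simp add: o_def)
  then show ?case using Suc by (simp add: linear_0[OF assms])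
qed simp

lemma alternating_form_vol:
  assumes "\<And>u v w. f [u, v, w] = vol (dz_vec G u) (dz_vec G v) (dz_vec G w)"
  shows "alternating_form 3 f"
  by (auto simp: numeral_3_eq_3 length_Suc_conv assms vol_alternating intro!: vol_linear_compose)

lemma alternating_form_omega: "alternating_form 2 (omega z)"
  by (auto simp: numeral_2_eq_2 length_Suc_conv omega_eq algebra_simps sum.distrib sum_subtractf
      sum_distrib_left intro!: linearI)

section \<open>The norm of the real part\<close>

definition std_basis :: "coord list" where
  "std_basis = [(axis 1 1, 0), (axis 2 1, 0), (axis 3 1, 0), (0, axis 1 1), (0, axis 2 1), (0, axis 3 1)]"

lemma set_std_basis: "set std_basis = Basis"
  by (auto simp: std_basis_def Basis_prod_def Basis_vec_def UNIV_3)

lemma distinct_std_basis: "distinct std_basis"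
  by (simp add: std_basis_def axis_eq_axis) 

lemma dz_vec_basis:
  "dz_vec G (axis k 1, 0) j = of_real (G $ k $ j)" "dz_vec G (0, axis k 1) j = (if j = k then \<i> else 0)"
  by (simp_all add: dz_vec_def complex_eq_iff axis_def if_distrib cong: if_cong)

lemma wedge_3_3:
  "wedge 3 3 \<alpha> \<beta> z [a, b, c, d, e, f] =
     \<alpha> z [a,b,c] * \<beta> z [d,e,f] - \<alpha> z [a,b,d] * \<beta> z [c,e,f] + \<alpha> z [a,b,e] * \<beta> z [c,d,f]
   - \<alpha> z [a,b,f] * \<beta> z [c,d,e] + \<alpha> z [a,c,d] * \<beta> z [b,e,f] - \<alpha> z [a,c,e] * \<beta> z [b,d,f]
   + \<alpha> z [a,c,f] * \<beta> z [b,d,e] + \<alpha> z [a,d,e] * \<beta> z [b,c,f] - \<alpha> z [a,d,f] * \<beta> z [b,c,e]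
   + \<alpha> z [a,e,f] * \<beta> z [b,c,d] - \<alpha> z [b,c,d] * \<beta> z [a,e,f] + \<alpha> z [b,c,e] * \<beta> z [a,d,f]
   - \<alpha> z [b,c,f] * \<beta> z [a,d,e] - \<alpha> z [b,d,e] * \<beta> z [a,c,f] + \<alpha> z [b,d,f] * \<beta> z [a,c,e]
   - \<alpha> z [b,e,f] * \<beta> z [a,c,d] + \<alpha> z [c,d,e] * \<beta> z [a,b,f] - \<alpha> z [c,d,f] * \<beta> z [a,b,e]
   + \<alpha> z [c,e,f] * \<beta> z [a,b,d] - \<alpha> z [d,e,f] * \<beta> z [a,b,c]"
  by (simp add: numeral_3_eq_3 wedge_Cons wedge_0_left wedge_0_right contract_def)

lemma omega_cubed_std_basis:
  "wedge 4 2 (wedge 2 2 omega omega) omega z std_basis = - 6"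
  unfolding std_basis_def
  by (simp add: eval_nat_numeral wedge_Cons wedge_0_left wedge_0_right contract_def omega_eq sum_3 axis_def)

text \<open>
  Evaluation on a basis of \<open>\<Omega> \<and> \<Omega>* = -2i Re \<Omega> \<and> Im \<Omega>\<close>, where \<open>\<Omega>*\<close> is the conjugate.
\<close>

lemma varphi_wedge_std_basis:
  assumes "\<And>u v w. f z [u, v, w] = vol (dz_vec G u) (dz_vec G v) (dz_vec G w)"
  shows "wedge 3 3 (\<lambda>z vs. Re (f z vs)) (\<lambda>z vs. Im (f z vs)) z std_basis = - 4 * det G"
  unfolding std_basis_def wedge_3_3 assms vol_def dz_vec_basis
  by (simp add: det_3 algebra_simps)

lemma norm_sq_eq:
  assumes f: "\<And>u v w. f z [u, v, w] = vol (dz_vec G u) (dz_vec G v) (dz_vec G w)"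
  shows "norm_sq (\<lambda>z vs. Re (f z vs)) (\<lambda>z vs. Im (f z vs)) z = 4 * det G"
  unfolding norm_sq_def
proof (rule the_equality)
  let ?\<phi> = "\<lambda>z vs. Re (f z vs)" and ?\<psi> = "\<lambda>z vs. Im (f z vs)"
  let ?\<omega>3 = "wedge 4 2 (wedge 2 2 omega omega) omega z"
  have alt: "alternating_form 3 (?\<phi> z)" "alternating_form 3 (?\<psi> z)"
    by (rule alternating_form_compose_linear[OF _ alternating_form_vol[OF f]],
        simp add: bounded_linear.linear bounded_linear_Re bounded_linear_Im)+
  have "alternating_form (2 + 2) (wedge 2 2 omega omega z)"
    by (rule alternating_form_wedge[OF alternating_form_omega alternating_form_omega])
  then have "alternating_form (4 + 2) ?\<omega>3"
    by (intro alternating_form_wedge alternating_form_omega) simp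
  then have alt\<omega>: "alternating_form 6 ?\<omega>3" by simp
  have "alternating_form 6 (wedge 3 3 ?\<phi> ?\<psi> z)"
    using alternating_form_wedge[where \<alpha> = ?\<phi> and \<beta> = ?\<psi>, OF alt] by simp
  then have alth: "alternating_form 6 (\<lambda>vs. wedge 3 3 ?\<phi> ?\<psi> z vs + (- (4 * det G) / 6) * ?\<omega>3 vs)"
    using alt\<omega> by (rule alternating_form_add[OF _ alternating_form_mult])
  have len: "length std_basis = 6" by (simp add: std_basis_def)
  have "wedge 3 3 ?\<phi> ?\<psi> z vs + (- (4 * det G) / 6) * ?\<omega>3 vs = 0" if "length vs = 6" for vs
  proof (rule top_form_eq_0[of std_basis])
    show "wedge 3 3 ?\<phi> ?\<psi> z std_basis + (- (4 * det G) / 6) * ?\<omega>3 std_basis = 0"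
      unfolding omega_cubed_std_basis varphi_wedge_std_basis[where f = f, OF f] by simp
  qed (use alth len that in \<open>simp_all only: set_std_basis distinct_std_basis span_Basis\<close>)
  then show "\<forall>vs. length vs = 6 \<longrightarrow> wedge 3 3 ?\<phi> ?\<psi> z vs = 4 * det G * (?\<omega>3 vs / fact 3)"
    by (simp add: fact_numeral)
  fix r assume "\<forall>vs. length vs = 6 \<longrightarrow> wedge 3 3 ?\<phi> ?\<psi> z vs = r * (?\<omega>3 vs / fact 3)"
  then have "wedge 3 3 ?\<phi> ?\<psi> z std_basis = r * (?\<omega>3 std_basis / fact 3)"
    using len by blast
  then show "r = 4 * det G"
    unfolding omega_cubed_std_basis varphi_wedge_std_basis[where f = f, OF f] by (simp add: fact_numeral)
qed

section \<open>The forms descend to the torus fibration\<close>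

text \<open>
  The linear part of a change of charts is determined near a point, so that every linear part
  allowed by \<open>transition\<close> is the one in \<open>SL3Z\<close>.
\<close>

lemma matrix_eq_if_agree_on_open:
  fixes M N :: "real^3^3"
  assumes "open S" "S \<noteq> {}" "\<And>v. v \<in> S \<Longrightarrow> M *v v + b = N *v v + d"
  shows "M = N"
proof -
  obtain x e where x: "x \<in> S" and e: "e > 0" "ball x e \<subseteq> S"
    using assms(1,2) open_contains_ball by (metis ex_in_conv)
  have "M *v w = N *v w" for w
  proof (cases "w = 0")
    case False
    define r where "r = e / (2 * norm w)"
    have r: "r > 0" using e False by (simp add: r_def)
    have "x + r *\<^sub>R w \<in> S"
      using e False by (intro subsetD[OF e(2)]) (simp add: dist_norm r_def)
    then have "(M *v (x + r *\<^sub>R w) + b) - (M *v x + b) = (N *v (x + r *\<^sub>R w) + d) - (N *v x + d)"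
      using assms(3) x by simp
    then have "r *\<^sub>R (M *v w) = r *\<^sub>R (N *v w)"
      by (simp add: matrix_vector_right_distrib matrix_vector_mult_scaleR)
    then show ?thesis using r by simp
  qed simp
  then show ?thesis by (simp add: matrix_eq)
qed

lemma transition_det_1:
  assumes B: "special_integral_affine_manifold B A" and c: "c \<in> A" "c' \<in> A"
    and tr: "transition B c c' p M b"
  shows "det M = 1"
proof -
  from tr obtain W where W: "openin B W" "p \<in> W" "W \<subseteq> fst c \<inter> fst c'"
    "\<forall>q\<in>W. snd c' q = M *v snd c q + b"
    unfolding transition_def by blast
  have "\<forall>p \<in> fst c \<inter> fst c'. \<exists>N\<in>SL3Z. \<exists>d. transition B c c' p N d"
    using B c by (simp add: special_integral_affine_manifold_def)
  then obtain N d where N: "N \<in> SL3Z" "transition B c c' p N d"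
    using W(2,3) by (meson subsetD)
  then obtain W' where W': "openin B W'" "p \<in> W'" "\<forall>q\<in>W'. snd c' q = N *v snd c q + d"
    unfolding transition_def by blast
  let ?V = "W \<inter> W'"
  have ch: "is_chart B c" using B c by (simp add: special_integral_affine_manifold_def)
  have "openin (subtopology B (fst c)) ?V"
    unfolding openin_subtopology using W W' by (intro exI[of _ ?V]) auto
  then have "openin (top_of_set (chart_image c)) (snd c ` ?V)"
    using ch homeomorphic_imp_open_map unfolding is_chart_def open_map_def by blast
  then have "open (snd c ` ?V)"
    using ch openin_open_eq unfolding is_chart_def by blast
  then have "M = N"
    by (rule matrix_eq_if_agree_on_open[where b = b and d = d]) (use W W' in auto)
  then show ?thesis using N by (simp add: SL3Z_def)
qed

lemma vol_matrix:
  "vol (\<lambda>j. \<Sum>k\<in>UNIV. of_real (M $ k $ j) * a k) (\<lambda>j. \<Sum>k\<in>UNIV. of_real (M $ k $ j) * b k)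
     (\<lambda>j. \<Sum>k\<in>UNIV. of_real (M $ k $ j) * c k) = of_real (det M) * vol a b c"
  unfolding vol_def det_3 sum_3 of_real_add of_real_diff of_real_mult by algebra

text \<open>
  The change of coordinates acts on the vector of the \<open>dz\<^sub>j\<close> by the transpose of \<open>M\<close>: on the real
  parts because \<open>G\<close> is a bilinear form, and on the imaginary parts because the fibre coordinates
  are those of a covector. With \<open>vol_matrix\<close>, \<open>\<Omega>\<close> changes by the factor \<open>det M\<close>.
\<close>

lemma dz_vec_transform:
  assumes "det M \<noteq> 0"
  shows "dz_vec (transpose M ** G ** M) (u, w) =
    (\<lambda>j. \<Sum>k\<in>UNIV. of_real (M $ k $ j) * dz_vec G (M *v u, matrix_inv (transpose M) *v w) k)"
proof
  fix j
  have "invertible (transpose M)" using assms by (simp add: invertible_det_nz det_transpose)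
  then have "transpose M ** matrix_inv (transpose M) = mat 1"
    unfolding invertible_def matrix_inv_def by (metis (mono_tags, lifting) someI_ex)
  then have tr: "transpose M *v (matrix_inv (transpose M) *v w) = w"
    by (simp add: matrix_vector_mul_assoc del: transpose_matrix_vector)
  have comp: "(transpose M *v V) $ j = (\<Sum>k\<in>UNIV. M $ k $ j * V $ k)" for V
    by (simp add: matrix_vector_mult_def transpose_def del: transpose_matrix_vector)
  have w: "w $ j = (\<Sum>k\<in>UNIV. M $ k $ j * (matrix_inv (transpose M) *v w) $ k)"
    using comp[of "matrix_inv (transpose M) *v w", unfolded tr] .
  show "dz_vec (transpose M ** G ** M) (u, w) j =
    (\<Sum>k\<in>UNIV. of_real (M $ k $ j) * dz_vec G (M *v u, matrix_inv (transpose M) *v w) k)"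
    by (simp add: complex_eq_iff dz_vec_def w[symmetric])
      (simp add: matrix_matrix_mult_def matrix_vector_mult_def transpose_def sum_3 algebra_simps)
qed

lemma Ck_on_vol:
  assumes "\<And>j. Ck_on k (\<lambda>z. a z j) S" "\<And>j. Ck_on k (\<lambda>z. b z j) S" "\<And>j. Ck_on k (\<lambda>z. c z j) S"
  shows "Ck_on k (\<lambda>z. vol (a z) (b z) (c z)) S"
proof -
  have minus: "Ck_on k (\<lambda>x. - f x) S" if "Ck_on k f S" for f :: "'a \<Rightarrow> complex"
    using Ck_on_bounded_linear[OF bounded_linear_minus[OF bounded_linear_ident] that] .
  show ?thesis
    unfolding vol_def diff_conv_add_uminus by (intro Ck_on_add Ck_on_mult minus assms)
qed

lemma Ck_on_dz_vec:
  assumes "Ck_on k G S"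
  shows "Ck_on k (\<lambda>z. dz_vec (G z) v j) S"
proof -
  have "linear (\<lambda>M :: real^3^3. complex_of_real (\<Sum>k\<in>UNIV. M $ k $ j * fst v $ k))"
    by (rule linearI) (simp_all add: scaleR_conv_of_real[where 'a = complex] sum.distrib sum_distrib_left algebra_simps)
  then have "Ck_on k (\<lambda>z. complex_of_real (\<Sum>k\<in>UNIV. G z $ k $ j * fst v $ k)) S"
    using Ck_on_bounded_linear[OF _ assms] linear_conv_bounded_linear by blast
  then have "Ck_on k (\<lambda>z. complex_of_real (\<Sum>k\<in>UNIV. G z $ k $ j * fst v $ k) + \<i> * of_real (snd v $ j)) S"
    by (rule Ck_on_add[OF _ Ck_on_const])
  then show ?thesis by (simp add: dz_vec_def Complex_eq)
qed

lemma alternating_multilinear_vol: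
  assumes f: "\<And>u v w. f [u, v, w] = T (vol (dz_vec G u) (dz_vec G v) (dz_vec G w))" and T: "linear T"
  shows "alternating_multilinear 3 f"
proof -
  have lin: "linear (\<lambda>u. T (vol (dz_vec G u) b c))" "linear (\<lambda>u. T (vol a (dz_vec G u) c))"
    "linear (\<lambda>u. T (vol a b (dz_vec G u)))" for a b c
    using linear_compose[OF vol_linear_compose(1) T] linear_compose[OF vol_linear_compose(2) T]
      linear_compose[OF vol_linear_compose(3) T] by (simp_all add: o_def)
  show ?thesis
    unfolding alternating_multilinear_def
    by (auto simp: numeral_3_eq_3 length_Suc_conv less_Suc_eq f vol_alternating linear_0[OF T] intro!: lin)
qed

text \<open>
  Stated for a real-linear image \<open>T\<close> of \<open>\<Omega>\<close> to cover the real and the imaginary part at once. The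
  expression of \<open>\<Omega>\<close> does not involve \<open>y\<close>, whence the invariance under the lattice.
\<close>

lemma differential_form_of_Omega:
  assumes B: "special_integral_affine_manifold B A" and g: "hessian_metric B A g"
    and T: "bounded_linear T"
  shows "differential_form B A 3 (\<lambda>c z vs. T (Omega g c z vs))"
proof -
  have Om: "Omega g c (x, y) [u, v, w] = vol (dz_vec (g c x) u) (dz_vec (g c x) v) (dz_vec (g c x) w)"
    if "c \<in> A" "x \<in> chart_image c" for c x y u v w
    using Omega_eq_vol g that unfolding hessian_metric_def by blast
  have alt: "alternating_multilinear 3 (\<lambda>vs. T (Omega g c z vs))"
    if "c \<in> A" "z \<in> coord_domain c" for c z
    using that by (cases z)
      (auto intro!: alternating_multilinear_vol bounded_linear.linear T simp: Om coord_domain_def)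
  have smooth: "smooth_on (coord_domain c) (\<lambda>z. T (Omega g c z vs))" if c: "c \<in> A" and "length vs = 3" for c vs
  proof -
    obtain u v w where vs: "vs = [u, v, w]" using \<open>length vs = 3\<close> by (auto simp: numeral_3_eq_3 length_Suc_conv)
    have "Ck_on k (g c) (chart_image c)" for k
      using g c unfolding hessian_metric_def riemannian_metric_def smooth_on_def by blast
    then have "Ck_on k (\<lambda>z. g c (fst z)) (coord_domain c)" for k
      unfolding coord_domain_def by (rule Ck_on_fst)
    then have "Ck_on k (\<lambda>z. T (vol (dz_vec (g c (fst z)) u) (dz_vec (g c (fst z)) v) (dz_vec (g c (fst z)) w)))
        (coord_domain c)" for k
      by (intro Ck_on_bounded_linear[OF T] Ck_on_vol Ck_on_dz_vec)
    then have "Ck_on k (\<lambda>z. T (Omega g c z vs)) (coord_domain c)" for k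
      by (rule Ck_on_cong) (auto simp: coord_domain_def Om c vs)
    then show ?thesis by (simp add: smooth_on_def)
  qed
  have inv: "Omega g c (snd c p, y) vs
      = Omega g c' (snd c' p, y') (map (\<lambda>(u, w). (M *v u, matrix_inv (transpose M) *v w)) vs)"
    if c: "c \<in> A" "c' \<in> A" and tr: "transition B c c' p M b" and l: "length vs = 3" for c c' p M b vs y y'
  proof -
    obtain u1 u2 v1 v2 w1 w2 where vs: "vs = [(u1, u2), (v1, v2), (w1, w2)]"
      using l by (auto simp: numeral_3_eq_3 length_Suc_conv)
    have p: "snd c p \<in> chart_image c" "snd c' p \<in> chart_image c'"
      using tr unfolding transition_def chart_image_def by auto
    have det: "det M = 1" using transition_det_1[OF B c tr] .
    have G: "g c (snd c p) = transpose M ** g c' (snd c' p) ** M"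
      using g c tr unfolding hessian_metric_def riemannian_metric_def by blast
    have nz: "det M \<noteq> 0" using det by simp
    show ?thesis
      unfolding vs Om[OF c(1) p(1)] G dz_vec_transform[OF nz] vol_matrix
      by (simp add: Om[OF c(2) p(2)] det)
  qed
  show ?thesis
    unfolding differential_form_def using alt smooth inv by (auto intro!: arg_cong[where f = T])
qed

section \<open>Calculus of the exterior derivative\<close>

text \<open>
  Both functions have the same derivatives at \<open>z\<close>, possibly none, so the choice made by \<open>frechet_derivative\<close> is the same.
\<close>

lemma frechet_derivative_cong_open:
  assumes "open S" "z \<in> S" "\<And>w. w \<in> S \<Longrightarrow> f w = g w"
  shows "frechet_derivative f (at z) = frechet_derivative g (at z)"
proof -
  have "(f has_derivative f') (at z) \<longleftrightarrow> (g has_derivative f') (at z)" for f'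
    using has_derivative_transform_within_open[of f f' z UNIV S g]
      has_derivative_transform_within_open[of g f' z UNIV S f] assms by auto
  then show ?thesis by (simp add: frechet_derivative_def)
qed

lemma ext_d_cong_open:
  assumes "open S" "z \<in> S" "\<And>w us. w \<in> S \<Longrightarrow> Suc (length us) = length vs \<Longrightarrow> \<alpha> w us = \<beta> w us"
  shows "ext_d \<alpha> z vs = ext_d \<beta> z vs"
  unfolding ext_d_def
proof (intro sum.cong refl)
  fix i assume "i \<in> {..<length vs}"
  then have "Suc (length (take i vs @ drop (Suc i) vs)) = length vs" by auto
  then have "frechet_derivative (\<lambda>w. \<alpha> w (take i vs @ drop (Suc i) vs)) (at z)
    = frechet_derivative (\<lambda>w. \<beta> w (take i vs @ drop (Suc i) vs)) (at z)"
    by (intro frechet_derivative_cong_open[OF assms(1,2)] assms(3))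
  then show "(- 1) ^ i *\<^sub>R frechet_derivative (\<lambda>w. \<alpha> w (take i vs @ drop (Suc i) vs)) (at z) (vs ! i)
    = (- 1) ^ i *\<^sub>R frechet_derivative (\<lambda>w. \<beta> w (take i vs @ drop (Suc i) vs)) (at z) (vs ! i)"
    by simp
qed

lemma ext_d_eq:
  assumes "\<And>us. Suc (length us) = length vs \<Longrightarrow> ((\<lambda>w. \<alpha> w us) has_derivative \<alpha>' us) (at z)"
  shows "ext_d \<alpha> z vs = (\<Sum>i<length vs. (-1) ^ i *\<^sub>R \<alpha>' (take i vs @ drop (Suc i) vs) (vs ! i))"
  unfolding ext_d_def
  by (intro sum.cong refl) (subst frechet_derivative_at[OF assms, symmetric]; simp)

text \<open>
  The Leibniz rule \<open>d(f \<alpha>) = df \<and> \<alpha> + f d\<alpha>\<close>.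
\<close>

lemma ext_d_scale:
  fixes \<alpha> :: "('a::real_normed_vector, real) dform"
  assumes f: "(f has_derivative f') (at z)"
    and \<alpha>: "\<And>us. Suc (length us) = length vs \<Longrightarrow> (\<lambda>w. \<alpha> w us) differentiable (at z)"
  shows "ext_d (\<lambda>w us. f w * \<alpha> w us) z vs =
    (\<Sum>i<length vs. (-1) ^ i * (f' (vs ! i) * \<alpha> z (take i vs @ drop (Suc i) vs))) + f z * ext_d \<alpha> z vs"
proof -
  have \<alpha>': "((\<lambda>w. \<alpha> w us) has_derivative frechet_derivative (\<lambda>w. \<alpha> w us) (at z)) (at z)"
    if "Suc (length us) = length vs" for us
    using \<alpha>[OF that] frechet_derivative_works by blast
  show ?thesis
    by (subst ext_d_eq[OF has_derivative_mult[OF f \<alpha>']])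
      (auto simp: ext_d_def sum.distrib sum_distrib_left algebra_simps)
qed

lemma ext_d_sum:
  assumes "\<And>j us. j \<in> J \<Longrightarrow> Suc (length us) = length vs \<Longrightarrow> (\<lambda>w. \<alpha> j w us) differentiable (at z)"
  shows "ext_d (\<lambda>w us. \<Sum>j\<in>J. \<alpha> j w us) z vs = (\<Sum>j\<in>J. ext_d (\<alpha> j) z vs)"
proof -
  have \<alpha>': "((\<lambda>w. \<alpha> j w us) has_derivative frechet_derivative (\<lambda>w. \<alpha> j w us) (at z)) (at z)"
    if "j \<in> J" "Suc (length us) = length vs" for j us
    using assms[OF that] frechet_derivative_works by blast
  show ?thesis
    by (subst ext_d_eq[OF has_derivative_sum[OF \<alpha>']])
      (auto simp: ext_d_def scaleR_sum_right intro: sum.swap)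
qed

lemma ext_d_bounded_linear:
  assumes T: "bounded_linear T"
    and \<alpha>: "\<And>us. Suc (length us) = length vs \<Longrightarrow> (\<lambda>w. \<alpha> w us) differentiable (at z)"
  shows "ext_d (\<lambda>w us. T (\<alpha> w us)) z vs = T (ext_d \<alpha> z vs)"
proof -
  interpret T: bounded_linear T by fact
  have \<alpha>': "((\<lambda>w. \<alpha> w us) has_derivative frechet_derivative (\<lambda>w. \<alpha> w us) (at z)) (at z)"
    if "Suc (length us) = length vs" for us
    using \<alpha>[OF that] frechet_derivative_works by blast
  show ?thesis
    by (subst ext_d_eq[OF T.has_derivative[OF \<alpha>']]) (auto simp: ext_d_def T.sum T.scaleR)
qed

section \<open>Closedness from the Hessian property\<close>

text \<open>
  Both sides are \<open>\<partial>\<^sub>u\<partial>\<^sub>v(\<partial>\<^sub>j\<phi>)\<close>.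
\<close>

lemma hessian_third_derivative_symmetric:
  assumes pot: "local_potential g c x \<phi>" and G': "(g c has_derivative G') (at x)"
  shows "(\<Sum>k\<in>UNIV. G' u $ k $ j * v $ k) = (\<Sum>k\<in>UNIV. G' v $ k $ j * u $ k)"
proof -
  from pot obtain W where W: "open W" "x \<in> W" "smooth_on W \<phi>"
    "\<forall>u\<in>W. \<forall>j k. g c u $ j $ k = partial j (partial k \<phi>) u"
    unfolding local_potential_def by blast
  define F where "F = (\<lambda>y v. \<Sum>k\<in>UNIV. v $ k * g c y $ k $ j)"
  have C: "Ck_on k (partial j \<phi>) W" for k
    using W(1,3) Ck_on_partial smooth_on_def by blast
  have F: "(partial j \<phi> has_derivative F y) (at y)" if "y \<in> W" for y
  proof -
    have d: "(partial j \<phi> has_derivative frechet_derivative (partial j \<phi>) (at y)) (at y)"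
      using W(1) C that Ck_on_differentiable by blast
    have "frechet_derivative (partial j \<phi>) (at y) = F y"
      using frechet_derivative_partial[OF d] W that by (auto simp: F_def)
    with d show ?thesis by simp
  qed
  have "((\<lambda>y. F y v) has_derivative (\<lambda>u. \<Sum>k\<in>UNIV. v $ k * G' u $ k $ j)) (at x)" for v
    unfolding F_def
    by (intro derivative_intros bounded_linear.has_derivative[OF bounded_linear_vec_nth] G')
  from second_derivative_symmetric[OF W(1,2) C F this this, of v u]
  show ?thesis by (simp add: mult.commute)
qed

lemma vol_has_derivative:
  assumes "\<And>j. ((\<lambda>w. a w j) has_derivative (\<lambda>h. a' h j)) (at z within S)"
    "\<And>j. ((\<lambda>w. b w j) has_derivative (\<lambda>h. b' h j)) (at z within S)"
    "\<And>j. ((\<lambda>w. c w j) has_derivative (\<lambda>h. c' h j)) (at z within S)"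
  shows "((\<lambda>w. vol (a w) (b w) (c w)) has_derivative
    (\<lambda>h. vol (a' h) (b z) (c z) + vol (a z) (b' h) (c z) + vol (a z) (b z) (c' h))) (at z within S)"
  unfolding vol_def
  by (rule has_derivative_eq_rhs, (rule derivative_intros assms)+) (simp add: algebra_simps fun_eq_iff)

lemma dz_vec_has_derivative:
  assumes "\<And>k j. ((\<lambda>w. G w $ k $ j) has_derivative (\<lambda>h. G' h k j)) (at z within S)"
  shows "((\<lambda>w. dz_vec (G w) v j) has_derivative
    (\<lambda>h. of_real (\<Sum>k\<in>UNIV. G' h k j * fst v $ k))) (at z within S)"
proof -
  have "((\<lambda>w. of_real (\<Sum>k\<in>UNIV. G w $ k $ j * fst v $ k) + \<i> * of_real (snd v $ j)) has_derivative
      (\<lambda>h. of_real (\<Sum>k\<in>UNIV. G' h k j * fst v $ k) + \<i> * 0)) (at z within S)"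
    by (rule has_derivative_eq_rhs, (rule derivative_intros assms)+) simp
  then show ?thesis by (simp add: dz_vec_def Complex_eq)
qed

lemma fst_compose_has_derivative:
  "(f has_derivative f') (at x) \<Longrightarrow> ((\<lambda>z. f (fst z)) has_derivative (\<lambda>v. f' (fst v))) (at (x, y))"
  using has_derivative_compose[where f = fst and g = f, OF has_derivative_fst[OF has_derivative_ident]]
  by fastforce

lemma dz_vec_fst_has_derivative:
  assumes "(G has_derivative G') (at x)"
  shows "((\<lambda>w. dz_vec (G (fst w)) v j) has_derivative
    (\<lambda>h. of_real (\<Sum>k\<in>UNIV. G' (fst h) $ k $ j * fst v $ k))) (at (x, y))"
  by (intro dz_vec_has_derivative bounded_linear.has_derivative[OF bounded_linear_vec_nth]
      fst_compose_has_derivative assms)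

text \<open>
  The complex 3-form \<open>vol(dz, dz, dz)\<close> of a matrix field \<open>G\<close>, and the 2-form \<open>vol(e, dz, dz)\<close> for
  a constant \<open>e\<close>. For \<open>e = i e\<^sub>j\<close> the latter is the contraction of the former with \<open>\<partial>/\<partial>y\<^sub>j\<close>.
\<close>

definition Omega_form :: "(real^3 \<Rightarrow> real^3^3) \<Rightarrow> (coord, complex) dform" where
  "Omega_form G = (\<lambda>w us. vol (dz_vec (G (fst w)) (us ! 0)) (dz_vec (G (fst w)) (us ! 1))
     (dz_vec (G (fst w)) (us ! 2)))"

definition Omega_slice :: "(3 \<Rightarrow> complex) \<Rightarrow> (real^3 \<Rightarrow> real^3^3) \<Rightarrow> (coord, complex) dform" where
  "Omega_slice e G = (\<lambda>w us. vol e (dz_vec (G (fst w)) (us ! 0)) (dz_vec (G (fst w)) (us ! 1)))"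

lemma
  assumes G: "(G has_derivative G') (at x)"
  shows Omega_form_differentiable: "(\<lambda>w. Omega_form G w us) differentiable (at (x, y))"
    and Omega_slice_differentiable: "(\<lambda>w. Omega_slice e G w us) differentiable (at (x, y))"
  unfolding Omega_form_def Omega_slice_def differentiable_def
  by (rule exI, rule vol_has_derivative; rule dz_vec_fst_has_derivative[OF G] has_derivative_const)+

text \<open>
  The derivative of \<open>dz(v)\<close> in direction \<open>u\<close> is a vector \<open>T(u, v)\<close>, symmetric by the Hessian
  property. In \<open>d\<close> the terms with \<open>T(v\<^sub>i, v\<^sub>k)\<close> and \<open>T(v\<^sub>k, v\<^sub>i)\<close> occur with opposite signs.
\<close>

lemma
  assumes G: "(G has_derivative G') (at x)"
    and sym: "\<And>u v j. (\<Sum>k\<in>UNIV. G' u $ k $ j * v $ k) = (\<Sum>k\<in>UNIV. G' v $ k $ j * u $ k)"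
  shows Omega_form_closed: "ext_d (Omega_form G) (x, y) [v0, v1, v2, v3] = 0"
    and Omega_slice_closed: "ext_d (Omega_slice e G) (x, y) [v0, v1, v2] = 0"
proof -
  define T where "T u v = (\<lambda>j. complex_of_real (\<Sum>k\<in>UNIV. G' (fst u) $ k $ j * fst v $ k))" for u v :: coord
  have T: "T u v = T v u" for u v
    unfolding T_def by (subst sym) simp
  have d: "((\<lambda>w. dz_vec (G (fst w)) v j) has_derivative (\<lambda>u. T u v j)) (at (x, y))" for v j
    unfolding T_def by (rule dz_vec_fst_has_derivative[OF G])
  note T' = T[of v1 v0] T[of v2 v0] T[of v3 v0] T[of v2 v1] T[of v3 v1] T[of v3 v2]
  show "ext_d (Omega_form G) (x, y) [v0, v1, v2, v3] = 0"
    unfolding Omega_form_def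
    by (subst ext_d_eq[OF vol_has_derivative[OF d d d]])
      (simp add: lessThan_nat_numeral eval_nat_numeral, simp add: T' vol_def algebra_simps)
  show "ext_d (Omega_slice e G) (x, y) [v0, v1, v2] = 0"
    unfolding Omega_slice_def
    by (subst ext_d_eq[OF vol_has_derivative[OF has_derivative_const d d]])
      (simp add: lessThan_nat_numeral eval_nat_numeral, simp add: T' vol_def algebra_simps)
qed

lemma Im_differentiable: "f differentiable F \<Longrightarrow> (\<lambda>w. Im (f w)) differentiable F"
  unfolding differentiable_def by (elim exE, rule exI, erule has_derivative_Im)

section \<open>Both sides of the flow equation\<close>

lemma smooth_on_det:
  fixes G :: "'a::real_normed_vector \<Rightarrow> real^3^3"
  assumes "smooth_on S G"
  shows "Ck_on k (\<lambda>x. det (G x)) S"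
proof -
  have entry: "Ck_on k (\<lambda>x. G x $ i $ j) S" for i j
    using assms unfolding smooth_on_def
    by (intro Ck_on_bounded_linear[where L = "\<lambda>M. M $ i $ j"]
        bounded_linear_compose[OF bounded_linear_vec_nth bounded_linear_vec_nth]) simp
  have minus: "Ck_on k (\<lambda>x. - f x) S" if "Ck_on k f S" for f :: "'a \<Rightarrow> real"
    using Ck_on_bounded_linear[OF bounded_linear_minus[OF bounded_linear_ident] that] .
  show ?thesis
    unfolding det_3 diff_conv_add_uminus by (intro Ck_on_add Ck_on_mult minus entry)
qed

text \<open>
  Multiplication by \<open>i\<close> in one row exchanges real and imaginary parts. This is how the contraction
  of \<open>Im \<Omega>\<close> with \<open>\<partial>/\<partial>y\<^sub>j\<close> produces terms of \<open>Re \<Omega>\<close>.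
\<close>

lemma vol_real_first:
  "Re (vol (\<lambda>j. of_real (r j)) a b) = (\<Sum>j\<in>UNIV. r j * Im (vol (\<lambda>m. if m = j then \<i> else 0) a b))"
  by (simp add: vol_def sum_3 algebra_simps)

lemma vol_cyclic: "vol b a c = - vol a b c" "vol b c a = vol a b c"
  by (simp_all add: vol_def algebra_simps)

text \<open>
  The left-hand side is \<open>\<Lambda>\<Omega>\<close>. It pairs the symmetric \<open>G\<^sub>j\<^sub>m\<close> with minors that are antisymmetric in
  \<open>j\<close> and \<open>m\<close>.
\<close>

lemma contracted_Omega_eq_0:
  assumes "transpose G = G"
  shows "(\<Sum>j\<in>UNIV. vol (dz_vec G (axis j 1, 0)) (dz_vec G (0, axis j 1)) a) = 0"
proof -
  have "G $ i $ j = G $ j $ i" for i j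
    using arg_cong[where f = "\<lambda>M. M $ i $ j", OF assms] by (simp add: transpose_def)
  from this[of 2 1] this[of 3 1] this[of 3 2] show ?thesis
    by (simp add: vol_def sum_3 dz_vec_basis algebra_simps)
qed

text \<open>
  The metric in a chart with image \<open>U\<close>; the assumption \<open>hessian\<close> is the symmetry supplied by
  \<open>hessian_third_derivative_symmetric\<close>.
\<close>

context
  fixes U :: "(real^3) set" and G :: "real^3 \<Rightarrow> real^3^3" and G' :: "real^3 \<Rightarrow> real^3 \<Rightarrow> real^3^3"
  assumes U: "open U" and smooth: "smooth_on U G"
    and symmetric: "\<And>x. x \<in> U \<Longrightarrow> transpose (G x) = G x"
    and G': "\<And>x. x \<in> U \<Longrightarrow> (G has_derivative G' x) (at x)"
    and hessian: "\<And>x u v j. x \<in> U \<Longrightarrow>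
      (\<Sum>k\<in>UNIV. G' x u $ k $ j * v $ k) = (\<Sum>k\<in>UNIV. G' x v $ k $ j * u $ k)"
begin

abbreviation "metric_det \<equiv> \<lambda>x. det (G x)"

lemma D_has_derivative:
  assumes "x \<in> U"
  shows "(metric_det has_derivative (\<lambda>v. \<Sum>j\<in>UNIV. v $ j * partial j metric_det x)) (at x)"
    "(partial i metric_det has_derivative (\<lambda>v. \<Sum>j\<in>UNIV. v $ j * partial j (partial i metric_det) x)) (at x)"
proof -
  have d: "(metric_det has_derivative frechet_derivative metric_det (at x)) (at x)"
    using Ck_on_differentiable[OF U smooth_on_det[OF smooth] assms] .
  then show "(metric_det has_derivative (\<lambda>v. \<Sum>j\<in>UNIV. v $ j * partial j metric_det x)) (at x)"
    using frechet_derivative_partial[OF d] by (metis (no_types, lifting) ext)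
  have d: "(partial i metric_det has_derivative frechet_derivative (partial i metric_det) (at x)) (at x)"
    using Ck_on_differentiable[OF U Ck_on_partial[OF U smooth_on_det[OF smooth]] assms] .
  then show "(partial i metric_det has_derivative (\<lambda>v. \<Sum>j\<in>UNIV. v $ j * partial j (partial i metric_det) x)) (at x)"
    using frechet_derivative_partial[OF d] by (metis (no_types, lifting) ext)
qed

text \<open>
  By closedness of \<open>\<Omega>\<close> only the derivative of the determinant survives in \<open>d\<close>. On the arguments
  \<open>\<partial>/\<partial>x\<^sup>j, \<partial>/\<partial>y\<^sub>j, a, b\<close> it is applied to \<open>\<partial>/\<partial>x\<^sup>j\<close>, to \<open>\<partial>/\<partial>y\<^sub>j\<close>, where it is zero, or to \<open>a\<close> or \<open>b\<close>,
  where the sum over \<open>j\<close> is zero by \<open>contracted_Omega_eq_0\<close>.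
\<close>

lemma Lambda_d_weighted_Omega:
  assumes "x \<in> U"
  shows "Lambda_omega (ext_d (\<lambda>w us. 4 * metric_det (fst w) * Im (Omega_form G w us))) (x, y) [a, b] =
    (\<Sum>j\<in>UNIV. 4 * partial j metric_det x * Im (Omega_slice (\<lambda>m. if m = j then \<i> else 0) G (x, y) [a, b]))"
proof -
  let ?D' = "\<lambda>v. \<Sum>j\<in>UNIV. v $ j * partial j metric_det x"
  have D: "((\<lambda>w. 4 * metric_det (fst w)) has_derivative (\<lambda>v. 4 * ?D' (fst v))) (at (x, y))"
    by (intro has_derivative_mult_right fst_compose_has_derivative D_has_derivative assms)
  have diff: "(\<lambda>w. Im (Omega_form G w us)) differentiable at (x, y)" for us
    by (intro Im_differentiable Omega_form_differentiable[OF G'[OF assms]])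
  have closed: "ext_d (\<lambda>w us. Im (Omega_form G w us)) (x, y) [v0, v1, v2, v3] = 0" for v0 v1 v2 v3
    using ext_d_bounded_linear[OF bounded_linear_Im Omega_form_differentiable[OF G'[OF assms]]]
      Omega_form_closed[OF G'[OF assms] hessian[OF assms]] by simp
  let ?e = "\<lambda>j. (axis j 1, 0) :: coord" and ?f = "\<lambda>j. (0, axis j 1) :: coord"
  let ?Z = "dz_vec (G x)"
  have D'e: "?D' (axis j 1) = partial j metric_det x" for j
    by (simp add: axis_def if_distrib if_distribR cong: if_cong)
  have "ext_d (\<lambda>w us. 4 * metric_det (fst w) * Im (Omega_form G w us)) (x, y) [?e j, ?f j, a, b] =
      4 * partial j metric_det x * Im (vol (?Z (?f j)) (?Z a) (?Z b))
      + (4 * ?D' (fst a)) * Im (vol (?Z (?e j)) (?Z (?f j)) (?Z b))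
      - (4 * ?D' (fst b)) * Im (vol (?Z (?e j)) (?Z (?f j)) (?Z a))" for j
    by (subst ext_d_scale[OF D diff])
      (simp add: closed lessThan_nat_numeral eval_nat_numeral D'e, simp add: Omega_form_def)
  then have "Lambda_omega (ext_d (\<lambda>w us. 4 * metric_det (fst w) * Im (Omega_form G w us))) (x, y) [a, b] =
      (\<Sum>j\<in>UNIV. 4 * partial j metric_det x * Im (vol (?Z (?f j)) (?Z a) (?Z b)))
      + (4 * ?D' (fst a)) * Im (\<Sum>j\<in>UNIV. vol (?Z (?e j)) (?Z (?f j)) (?Z b))
      - (4 * ?D' (fst b)) * Im (\<Sum>j\<in>UNIV. vol (?Z (?e j)) (?Z (?f j)) (?Z a))"
    unfolding Lambda_omega_def contract_def Im_sum
    by (simp only: sum.distrib sum_subtractf sum_distrib_left)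
  then show ?thesis
    unfolding contracted_Omega_eq_0[OF symmetric[OF assms]]
    by (simp add: Omega_slice_def dz_vec_basis(2)[abs_def])
qed

text \<open>
  \<open>H v\<close> is the vector of the values \<open>1/4 d(\<partial>\<^sub>jD)(v)\<close> for \<open>D = det G\<close>. Once more only the
  coefficients \<open>\<partial>\<^sub>jD\<close> are differentiated, the 2-forms being closed.
\<close>

lemma d_Lambda_d_weighted_Omega:
  assumes "x \<in> U"
  defines "H \<equiv> \<lambda>v j. of_real (\<Sum>k\<in>UNIV. 1/4 * partial k (partial j metric_det) x * fst v $ k)"
  shows "1/16 * ext_d (Lambda_omega (ext_d (\<lambda>w us. 4 * metric_det (fst w) * Im (Omega_form G w us)))) (x, y) [v0, v1, v2]
    = Re (vol (H v0) (dz_vec (G x) v1) (dz_vec (G x) v2) + vol (dz_vec (G x) v0) (H v1) (dz_vec (G x) v2)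
       + vol (dz_vec (G x) v0) (dz_vec (G x) v1) (H v2))"
proof -
  let ?e = "\<lambda>j m. if m = j then \<i> else 0 :: complex"
  let ?\<gamma> = "\<lambda>j w us. Im (Omega_slice (?e j) G w us)"
  let ?Z = "dz_vec (G x)"
  let ?h = "\<lambda>j v. \<Sum>k\<in>UNIV. v $ k * partial k (partial j metric_det) x"
  have D: "((\<lambda>w. 4 * partial j metric_det (fst w)) has_derivative (\<lambda>v. 4 * ?h j (fst v))) (at (x, y))" for j
    by (intro has_derivative_mult_right fst_compose_has_derivative D_has_derivative assms)
  have diff: "(\<lambda>w. ?\<gamma> j w us) differentiable at (x, y)" for j us
    by (intro Im_differentiable Omega_slice_differentiable[OF G'[OF assms(1)]])
  have diff': "(\<lambda>w. 4 * partial j metric_det (fst w) * ?\<gamma> j w us) differentiable at (x, y)" for j us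
    using diff[of j us] D[of j] has_derivative_mult unfolding differentiable_def by blast
  have closed: "ext_d (?\<gamma> j) (x, y) [v0, v1, v2] = 0" for j
    using ext_d_bounded_linear[OF bounded_linear_Im Omega_slice_differentiable[OF G'[OF assms(1)]]]
      Omega_slice_closed[OF G'[OF assms(1)] hessian[OF assms(1)]] by simp
  have "ext_d (Lambda_omega (ext_d (\<lambda>w us. 4 * metric_det (fst w) * Im (Omega_form G w us)))) (x, y) [v0, v1, v2]
    = ext_d (\<lambda>w us. \<Sum>j\<in>UNIV. 4 * partial j metric_det (fst w) * ?\<gamma> j w us) (x, y) [v0, v1, v2]"
  proof (rule ext_d_cong_open[of "U \<times> UNIV"])
    fix w :: coord and us :: "coord list"
    assume "w \<in> U \<times> UNIV" "Suc (length us) = length [v0, v1, v2]"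
    then show "Lambda_omega (ext_d (\<lambda>w us. 4 * metric_det (fst w) * Im (Omega_form G w us))) w us
        = (\<Sum>j\<in>UNIV. 4 * partial j metric_det (fst w) * ?\<gamma> j w us)"
      using Lambda_d_weighted_Omega by (auto simp: length_Suc_conv)
  qed (use U assms(1) open_Times in auto)
  also have "\<dots> = (\<Sum>j\<in>UNIV. ext_d (\<lambda>w us. 4 * partial j metric_det (fst w) * ?\<gamma> j w us) (x, y) [v0, v1, v2])"
    by (rule ext_d_sum[OF diff'])
  also have "\<dots> = (\<Sum>j\<in>UNIV. 4 * ?h j (fst v0) * Im (vol (?e j) (?Z v1) (?Z v2))
      - 4 * ?h j (fst v1) * Im (vol (?e j) (?Z v0) (?Z v2))
      + 4 * ?h j (fst v2) * Im (vol (?e j) (?Z v0) (?Z v1)))"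
    by (subst ext_d_scale[OF D diff])
      (simp add: closed lessThan_nat_numeral eval_nat_numeral, simp add: Omega_slice_def)
  also have "\<dots> = 4 * (\<Sum>j\<in>UNIV. ?h j (fst v0) * Im (vol (?e j) (?Z v1) (?Z v2)))
      - 4 * (\<Sum>j\<in>UNIV. ?h j (fst v1) * Im (vol (?e j) (?Z v0) (?Z v2)))
      + 4 * (\<Sum>j\<in>UNIV. ?h j (fst v2) * Im (vol (?e j) (?Z v0) (?Z v1)))"
    by (simp add: sum.distrib sum_subtractf mult.assoc flip: sum_distrib_left)
  also have "\<dots> = 4 * Re (vol (\<lambda>j. of_real (?h j (fst v0))) (?Z v1) (?Z v2))
      - 4 * Re (vol (\<lambda>j. of_real (?h j (fst v1))) (?Z v0) (?Z v2))
      + 4 * Re (vol (\<lambda>j. of_real (?h j (fst v2))) (?Z v0) (?Z v1))"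
    by (simp only: vol_real_first)
  finally have eq: "1/16 * ext_d (Lambda_omega (ext_d (\<lambda>w us. 4 * metric_det (fst w) * Im (Omega_form G w us)))) (x, y) [v0, v1, v2]
    = Re (of_real (1/4) * vol (\<lambda>j. of_real (?h j (fst v0))) (?Z v1) (?Z v2)
      - of_real (1/4) * vol (\<lambda>j. of_real (?h j (fst v1))) (?Z v0) (?Z v2)
      + of_real (1/4) * vol (\<lambda>j. of_real (?h j (fst v2))) (?Z v0) (?Z v1))"
    by (simp only: minus_complex.sel plus_complex.sel times_complex.sel Re_complex_of_real Im_complex_of_real) simp
  have H: "H v = (\<lambda>j. of_real (1/4) * of_real (?h j (fst v)))" for v
    unfolding H_def of_real_mult[symmetric] sum_distrib_left by (simp add: mult_ac)
  show ?thesis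
    unfolding eq vol_cyclic(1)[of "?Z v0" "H v1" "?Z v2"] vol_cyclic(2)[of "?Z v0" "?Z v1" "H v2"]
    by (simp only: H vol_linear) simp
qed

end

text \<open>
  The product rule for the determinant. The derivative is taken along the entries of \<open>G\<close>, because
  the flow is given entrywise; \<open>H v\<close> is the time derivative of \<open>dz(v)\<close>.
\<close>

lemma varphi_has_real_derivative:
  assumes "t \<in> I"
    and G: "\<And>s. s \<in> I \<Longrightarrow> f s = vol (dz_vec (G s) v0) (dz_vec (G s) v1) (dz_vec (G s) v2)"
    and h: "\<And>j k. ((\<lambda>s. G s $ k $ j) has_real_derivative h k j) (at t within I)"
  defines "H \<equiv> \<lambda>v j. of_real (\<Sum>k\<in>UNIV. h k j * fst v $ k)"
  shows "((\<lambda>s. Re (f s)) has_real_derivative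
    Re (vol (H v0) (dz_vec (G t) v1) (dz_vec (G t) v2) + vol (dz_vec (G t) v0) (H v1) (dz_vec (G t) v2)
       + vol (dz_vec (G t) v0) (dz_vec (G t) v1) (H v2))) (at t within I)"
proof -
  have "((\<lambda>s. G s $ k $ j) has_derivative (\<lambda>r. r * h k j)) (at t within I)" for k j
    using h[of k j, unfolded has_field_derivative_def]
    by (rule has_derivative_eq_rhs) (simp add: fun_eq_iff)
  then have d: "((\<lambda>s. dz_vec (G s) v j) has_derivative (\<lambda>r. of_real r * H v j)) (at t within I)" for v j
    by (rule has_derivative_eq_rhs[OF dz_vec_has_derivative])
      (simp add: H_def sum_distrib_left mult.assoc fun_eq_iff)
  note deriv = has_derivative_Re[OF vol_has_derivative[OF d[where v = v0] d[where v = v1] d[where v = v2]]]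
  have "((\<lambda>s. Re (vol (dz_vec (G s) v0) (dz_vec (G s) v1) (dz_vec (G s) v2))) has_real_derivative
    Re (vol (H v0) (dz_vec (G t) v1) (dz_vec (G t) v2) + vol (dz_vec (G t) v0) (H v1) (dz_vec (G t) v2)
       + vol (dz_vec (G t) v0) (dz_vec (G t) v1) (H v2))) (at t within I)"
    unfolding has_field_derivative_def
    by (rule has_derivative_eq_rhs[OF deriv[unfolded vol_linear]]) (simp add: fun_eq_iff algebra_simps)
  then show ?thesis
    unfolding has_field_derivative_def
    by (rule has_derivative_eq_on[OF _ assms(1)]) (simp add: G)
qed

theorem theorem2p1:
  fixes B :: "'b topology" and A :: "'b chart set"
    and I :: "real set" and g :: "real \<Rightarrow> 'b metric"
  assumes "special_integral_affine_manifold B A"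
    and "compact_space B"
    and "is_interval I" and "interior I \<noteq> {}"
    and "\<forall>t\<in>I. hessian_metric B A (g t)"
    and "smooth_family A I g"
    and "semiflat_type_IIB_flow A I g"
  shows "(\<forall>t\<in>I. differential_form B A 3 (varphi (g t)) \<and> differential_form B A 3 (varphi_hat (g t))) \<and>
    (\<forall>t\<in>I. \<forall>c\<in>A. \<forall>z\<in>coord_domain c. \<forall>vs. length vs = 3 \<longrightarrow>
       ((\<lambda>s. varphi (g s) c z vs) has_real_derivative
          1/16 * ext_d (Lambda_omega (ext_d (\<lambda>w us.
             norm_sq (varphi (g t) c) (varphi_hat (g t) c) w * varphi_hat (g t) c w us))) z vs)
        (at t within I))"
proof (intro conjI ballI allI impI)
  fix t assume t: "t \<in> I"
  then have hess: "hessian_metric B A (g t)" using assms(5) by blast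
  show "differential_form B A 3 (varphi (g t))" "differential_form B A 3 (varphi_hat (g t))"
    unfolding varphi_def[abs_def] varphi_hat_def[abs_def]
    by (rule differential_form_of_Omega[OF assms(1) hess] bounded_linear_Re bounded_linear_Im)+
  fix c z and vs :: "coord list"
  assume c: "c \<in> A" and z: "z \<in> coord_domain c" and vs: "length vs = 3"
  define U where "U = chart_image c"
  define G where "G = g t c"
  obtain x y where xy: "z = (x, y)" and x: "x \<in> U"
    using z by (auto simp: coord_domain_def U_def)
  obtain v0 v1 v2 where v: "vs = [v0, v1, v2]"
    using vs by (auto simp: numeral_3_eq_3 length_Suc_conv)
  have U: "open U"
    using assms(1) c by (simp add: special_integral_affine_manifold_def is_chart_def U_def)
  have pot: "\<exists>\<phi>. local_potential (g s) c u \<phi>" if "s \<in> I" "u \<in> U" for s u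
    using assms(5) that c by (simp add: hessian_metric_def U_def)
  have Om: "Omega (g s) c (u, r) [a, b, d] = vol (dz_vec (g s c u) a) (dz_vec (g s c u) b) (dz_vec (g s c u) d)"
    if "s \<in> I" "u \<in> U" for s u r a b d
    by (rule Omega_eq_vol[OF pot[OF that]])
  have smooth: "smooth_on U G" and sym: "\<And>u. u \<in> U \<Longrightarrow> transpose (G u) = G u"
    using hess c by (simp_all add: hessian_metric_def riemannian_metric_def G_def U_def)
  define G' where "G' u = frechet_derivative G (at u)" for u
  have G': "(G has_derivative G' u) (at u)" if "u \<in> U" for u
    using Ck_on_differentiable[OF U _ that] smooth unfolding smooth_on_def G'_def by blast
  have hessian: "(\<Sum>k\<in>UNIV. G' u a $ k $ j * b $ k) = (\<Sum>k\<in>UNIV. G' u b $ k $ j * a $ k)"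
    if "u \<in> U" for u a b j
    using pot[OF t that] hessian_third_derivative_symmetric G'[OF that] unfolding G_def by blast
  have dom: "open (U \<times> (UNIV :: (real^3) set))" using U by (simp add: open_Times)
  \<comment> \<open>the weighted form agrees with the explicit one only over the chart image, an open set\<close>
  have weighted: "norm_sq (varphi (g t) c) (varphi_hat (g t) c) w * varphi_hat (g t) c w us
      = 4 * det (G (fst w)) * Im (Omega_form G w us)"
    if w_in: "w \<in> U \<times> UNIV" and us: "length us = 3" for w us
  proof -
    obtain u r where w: "w = (u, r)" "u \<in> U" using w_in by auto
    have "norm_sq (varphi (g t) c) (varphi_hat (g t) c) w = 4 * det (G u)"
      unfolding varphi_def[abs_def] varphi_hat_def[abs_def]
      by (rule norm_sq_eq) (simp add: w Om t G_def)
    moreover have "varphi_hat (g t) c w us = Im (Omega_form G w us)"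
      using us by (auto simp: numeral_3_eq_3 length_Suc_conv varphi_hat_def Omega_form_def w Om t G_def)
    ultimately show ?thesis by (simp add: w)
  qed
  have rhs: "ext_d (Lambda_omega (ext_d (\<lambda>w us.
         norm_sq (varphi (g t) c) (varphi_hat (g t) c) w * varphi_hat (g t) c w us))) z vs =
      ext_d (Lambda_omega (ext_d (\<lambda>w us. 4 * det (G (fst w)) * Im (Omega_form G w us)))) (x, y) [v0, v1, v2]"
    unfolding xy v
  proof (rule ext_d_cong_open[OF dom])
    fix w :: coord and us :: "coord list"
    assume w: "w \<in> U \<times> UNIV" and us: "Suc (length us) = length [v0, v1, v2]"
    show "Lambda_omega (ext_d (\<lambda>w us.
         norm_sq (varphi (g t) c) (varphi_hat (g t) c) w * varphi_hat (g t) c w us)) w us =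
      Lambda_omega (ext_d (\<lambda>w us. 4 * det (G (fst w)) * Im (Omega_form G w us))) w us"
      unfolding Lambda_omega_def contract_def
      by (intro sum.cong refl ext_d_cong_open[OF dom w] weighted) (use us in simp_all)
  qed (use x in simp)
  let ?h = "\<lambda>k j. 1/4 * partial k (partial j (\<lambda>u. det (G u))) x"
  have flow: "((\<lambda>s. g s c x $ k $ j) has_real_derivative ?h k j) (at t within I)" for k j
    using assms(7) t c x by (simp add: semiflat_type_IIB_flow_def G_def U_def)
  show "((\<lambda>s. varphi (g s) c z vs) has_real_derivative
      1/16 * ext_d (Lambda_omega (ext_d (\<lambda>w us.
         norm_sq (varphi (g t) c) (varphi_hat (g t) c) w * varphi_hat (g t) c w us))) z vs)
      (at t within I)"
    unfolding rhs
    by (simp only: d_Lambda_d_weighted_Omega[OF U smooth sym G' hessian x],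
        unfold varphi_def xy v G_def,
        rule varphi_has_real_derivative[OF t Om flow[unfolded G_def]])
      (use x in auto)
qed

end
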